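(* Let $0<b<1$, $\omega\in\mathbb{R}$, $l\in\mathbb{N}$, $m\in\{-l,\dots,l\}\setminus\{0\}$, and let $Y_l^m\in\mathbb{E}_{l,m}$ be non-zonal (i.e. not identically zero, hence depending on $\varphi$). Suppose $g_1,g_2\in C^{3,\alpha}\left(\left(-\frac{\pi}{2},\frac{\pi}{2}\right)\right)$ satisfy $\lim_{\theta\to\pm\frac{\pi}{2}}g_i'(\theta)=0$ and that, for $i=1,2$, $\psi_i(\varphi,\theta)=g_i(\theta)+Y_l^m(\varphi,\theta)$ solves the stationary Euler equations \[ \left[-\partial_\theta\psi\,\partial_\varphi+\partial_\varphi\psi\,\partial_\theta\right]\left(\Delta\psi+\frac{2\omega\sin\theta}{\rho(\theta)}\right)=0 . \] Then $g_1-g_2$ is constant. Consequently the velocity field $U=J\operatorname{grad}\psi$ is uniquely determined by $Y_l^m$.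
   Context: The surface $\mathbb{S}^2$ denotes the biaxial ellipsoid with major axis $1$ and minor axis $b\in(0,1)$, parametrized by $(\varphi,\theta)\in[-\pi,\pi)\times[-\frac{\pi}{2},\frac{\pi}{2}]\mapsto(\cos\varphi\cos\theta,\sin\varphi\cos\theta,b\sin\theta)$; functions are $2\pi$-periodic in $\varphi$. Write $\rho(\theta)=\sqrt{\sin^2\theta+b^2\cos^2\theta}$. The Laplace–Beltrami operator is $\Delta\psi=\frac{1}{\cos^2\theta}\partial_{\varphi\varphi}\psi+\frac{1}{\cos\theta\,\rho(\theta)}\partial_\theta\!\left(\frac{\cos\theta}{\rho(\theta)}\partial_\theta\psi\right)$. For $l\in\mathbb{N}$, $m\in\{-l,\dots,l\}$, $\mathbb{E}_{l,m}$ is the $(l,m)$-th eigenspace of $-\Delta$ with eigenvalue $\lambda_{l,m}$; for $m\neq0$ it is assumed that $\mathbb{E}_{l,m}$ has an $L^2(\mathbb{S}^2,d\sigma)$-orthonormal basis $\{y_1(\theta)e^{im\varphi},\,y_2(\theta)e^{-im\varphi}\}$ with smooth $y_1,y_2$, where $d\sigma=\cos\theta\,\rho(\theta)\,d\varphi\,d\theta$. The velocity field of a stream function $\psi$ is $U=J\operatorname{grad}\psi=\left(-\frac{1}{\rho(\theta)}\partial_\theta\psi,\ \frac{1}{\cos\theta}\partial_\varphi\psi\right)$ in the orthonormal frame $\mathbf{e}_\varphi=\frac{1}{\cos\theta}\partial_\varphi$, $\mathbf{e}_\theta=\frac{1}{\rho(\theta)}\partial_\theta$. $C^{3,\alpha}$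 denotes a Hölder space with exponent $\alpha\in(0,1)$. *)

theory Defs
  imports "HOL-Analysis.Analysis"
begin

text \<open>Coordinates: a point of the parameter domain is a pair (phi, theta).\<close>

definition rho :: "real \<Rightarrow> real \<Rightarrow> real" where
  "rho b \<theta> = sqrt ((sin \<theta>)\<^sup>2 + b\<^sup>2 * (cos \<theta>)\<^sup>2)"

definition ell_param :: "real \<Rightarrow> real \<times> real \<Rightarrow> real \<times> real \<times> real" where
  "ell_param b p = (cos (fst p) * cos (snd p), sin (fst p) * cos (snd p), b * sin (snd p))"

definition ellipsoid :: "real \<Rightarrow> (real \<times> real \<times> real) set" where
  "ellipsoid b = ell_param b ` ({-pi..<pi} \<times> {-pi/2..pi/2})"

fun Ck_on :: "nat \<Rightarrow> 'a::real_normed_vector set \<Rightarrow> ('a \<Rightarrow> 'b::real_normed_vector) \<Rightarrow> bool" where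
  "Ck_on 0 S f = continuous_on S f"
| "Ck_on (Suc n) S f =
     (f differentiable_on S \<and> (\<forall>v. Ck_on n S (\<lambda>x. frechet_derivative f (at x) v)))"

definition Cinf_on :: "'a::real_normed_vector set \<Rightarrow> ('a \<Rightarrow> 'b::real_normed_vector) \<Rightarrow> bool" where
  "Cinf_on S f \<longleftrightarrow> (\<forall>n. Ck_on n S f)"

text \<open>Hoelder space C^{3,alpha}(S) (locally Hoelder third derivative, as in Gilbarg--Trudinger).\<close>
definition C3alpha :: "real \<Rightarrow> real set \<Rightarrow> (real \<Rightarrow> real) \<Rightarrow> bool" where
  "C3alpha \<alpha> S g \<longleftrightarrow>
     (\<forall>k<3. \<forall>x\<in>S. ((deriv ^^ k) g has_real_derivative (deriv ^^ Suc k) g x) (at x)) \<and>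
     continuous_on S ((deriv ^^ 3) g) \<and>
     (\<forall>K. compact K \<and> K \<subseteq> S \<longrightarrow>
        (\<exists>C. \<forall>x\<in>K. \<forall>y\<in>K. \<bar>(deriv ^^ 3) g x - (deriv ^^ 3) g y\<bar> \<le> C * \<bar>x - y\<bar> powr \<alpha>))"

definition dphi :: "(real \<times> real \<Rightarrow> complex) \<Rightarrow> real \<times> real \<Rightarrow> complex" where
  "dphi F p = vector_derivative (\<lambda>s. F (s, snd p)) (at (fst p))"

definition dtheta :: "(real \<times> real \<Rightarrow> complex) \<Rightarrow> real \<times> real \<Rightarrow> complex" where
  "dtheta F p = vector_derivative (\<lambda>t. F (fst p, t)) (at (snd p))"

text \<open>Laplace--Beltrami operator on the ellipsoid in (phi, theta) coordinates.\<close>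
definition LB :: "real \<Rightarrow> (real \<times> real \<Rightarrow> complex) \<Rightarrow> real \<times> real \<Rightarrow> complex" where
  "LB b F p =
     (1 / (cos (snd p))\<^sup>2) *\<^sub>R dphi (dphi F) p +
     (1 / (cos (snd p) * rho b (snd p))) *\<^sub>R
        dtheta (\<lambda>q. (cos (snd q) / rho b (snd q)) *\<^sub>R dtheta F q) p"

definition smooth_on_ellipsoid :: "real \<Rightarrow> (real \<times> real \<Rightarrow> complex) \<Rightarrow> bool" where
  "smooth_on_ellipsoid b F \<longleftrightarrow>
     (\<exists>G U. open U \<and> ellipsoid b \<subseteq> U \<and> Cinf_on U G \<and> (\<forall>p. F p = G (ell_param b p)))"

definition eigenspace_LB :: "real \<Rightarrow> real \<Rightarrow> (real \<times> real \<Rightarrow> complex) set" where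
  "eigenspace_LB b lam =
     {F. smooth_on_ellipsoid b F \<and>
         (\<forall>p. snd p \<in> {-pi/2<..<pi/2} \<longrightarrow> - LB b F p = of_real lam * F p)}"

text \<open>L^2(S^2, d sigma) inner product, d sigma = cos theta rho(theta) d phi d theta.\<close>
definition L2_inner :: "real \<Rightarrow> (real \<times> real \<Rightarrow> complex) \<Rightarrow> (real \<times> real \<Rightarrow> complex) \<Rightarrow> complex" where
  "L2_inner b F G =
     (LINT p : {-pi..pi} \<times> {-pi/2..pi/2} | lborel.
        F p * cnj (G p) * of_real (cos (snd p) * rho b (snd p)))"

definition stationary_euler :: "real \<Rightarrow> real \<Rightarrow> (real \<times> real \<Rightarrow> complex) \<Rightarrow> bool" where
  "stationary_euler b \<omega> \<psi> \<longleftrightarrow>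
     (let W = (\<lambda>p. LB b \<psi> p + of_real (2 * \<omega> * sin (snd p) / rho b (snd p)))
      in \<forall>p. snd p \<in> {-pi/2<..<pi/2} \<longrightarrow>
            - dtheta \<psi> p * dphi W p + dphi \<psi> p * dtheta W p = 0)"

text \<open>Velocity field U = J grad psi in the orthonormal frame (e_phi, e_theta).\<close>
definition velocity :: "real \<Rightarrow> (real \<times> real \<Rightarrow> complex) \<Rightarrow> real \<times> real \<Rightarrow> complex \<times> complex" where
  "velocity b \<psi> p =
     (- (1 / rho b (snd p)) *\<^sub>R dtheta \<psi> p, (1 / cos (snd p)) *\<^sub>R dphi \<psi> p)"

end

theory Submission
  imports Defs
begin

text \<open>
  Put \<open>Y\<close> into the Euler equation. Since \<open>\<Delta>Y = - \<lambda> Y\<close>, everything cancels except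
  \<open>\<partial>\<^sub>\<phi>Y (\<Delta>g + \<lambda> g + 2 \<omega> sin \<theta> / \<rho>)' = 0\<close>, and \<open>\<partial>\<^sub>\<phi>Y\<close> vanishes identically on no open set of latitudes because
  its Fourier coefficients solve a linear second order equation. Hence \<open>\<Delta>g + \<lambda> g\<close> is the same for
  \<open>g\<^sub>1\<close> and \<open>g\<^sub>2\<close> up to a constant, so \<open>H = g\<^sub>1 - g\<^sub>2 - c\<close> satisfies \<open>\<Delta>H + \<lambda> H = 0\<close> for a suitable \<open>c\<close>.
  In the variable \<open>s = sin \<theta>\<close> this equation has a regular singular point with double exponent \<open>0\<close> at each
  pole \<open>s = \<plusminus>1\<close>; the condition \<open>H' \<rightarrow> 0\<close> excludes the logarithmic solution, so \<open>H\<close> is a convergent power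
  series there and is a smooth function on the whole ellipsoid. It therefore lies in the eigenspace of \<open>\<lambda>\<close>,
  which contains no nonzero zonal function.
\<close>

text \<open>The basis assumption speaks only about members of \<open>eigenspace_LB\<close>, and
  membership demands a smooth extension to an open subset of R^3 around the whole ellipsoid, poles
  included. Solving the equation for H between the poles is thus not enough, and this shapes the
  proof. On the ellipsoid sin \<theta> is the linear function z / b, so it suffices to extend the
  profile K(s) = H(arcsin s) smoothly to an open set containing [-1, 1]. Between the poles, two
  derivatives of K and the polynomial equation yield all the others; near a pole K is matched with
  the series by a Wronskian argument. The weight of that Wronskian vanishes to first order in t = 1
  - |s|, so the logarithm is excluded once t K and t K' tend to 0. Since K' = H' / cos \<theta> and
  cos \<theta> >= t, the limit of H' gives exactly this.

  The constant c is a quotient by \<open>lam\<close>, so \<open>lam\<close> must be nonzero. This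
  too comes from the basis: for \<open>lam\<close> = 0 the constant 1 would be a zonal
  eigenfunction.\<close>

subsection \<open>Smoothness of one-variable profiles\<close>

text \<open>On an open set, equality of functions is equality of germs, so Frechet derivatives agree
  as well and the recursion in \<open>Ck_on\<close> can be followed.\<close>

lemma Ck_on_cong:
  assumes "open S" "\<And>x. x \<in> S \<Longrightarrow> f x = g x" "Ck_on n S f"
  shows "Ck_on n S g"
  using assms(2,3)
proof (induction n arbitrary: f g)
  case 0
  then show ?case by (simp cong: continuous_on_cong)
next
  case (Suc n)
  have df: "f differentiable (at x)" if "x \<in> S" for x
    using Suc.prems(2) that \<open>open S\<close> by (simp add: differentiable_on_eq_differentiable_at)
  have "frechet_derivative f (at x) = frechet_derivative g (at x)" if "x \<in> S" for x
    using frechet_derivative_transform_within_open[OF df[OF that] \<open>open S\<close> that] Suc.prems(1) by auto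
  then have "Ck_on n S (\<lambda>x. frechet_derivative g (at x) v)" for v
    using Suc.IH[of "\<lambda>x. frechet_derivative f (at x) v" "\<lambda>x. frechet_derivative g (at x) v"] Suc.prems(2)
    by auto
  moreover have "g differentiable_on S"
    unfolding differentiable_on_eq_differentiable_at[OF \<open>open S\<close>]
    using df Suc.prems(1) \<open>open S\<close>
    by (meson differentiable_def has_derivative_transform_within_open)
  ultimately show ?case by simp
qed

lemma Ck_on_Un:
  assumes "open S" "open T" "Ck_on n S f" "Ck_on n T f"
  shows "Ck_on n (S \<union> T) f"
  using assms(3,4)
proof (induction n arbitrary: f)
  case 0
  then show ?case using assms by (simp add: continuous_on_open_Un)
next
  case (Suc n)
  then show ?case
    using assms(1,2) by (auto simp: differentiable_on_eq_differentiable_at open_Un)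
qed

text \<open>Induction on n works for all members of the family at once, because the derivative of a
  member is again a member. As \<open>h\<close> is linear, the chain rule in direction v contributes
  only the constant \<open>h v\<close>, which the free scalar \<open>c\<close> absorbs.\<close>

lemma Ck_on_derivative_closed_family:
  fixes h :: "'a::real_normed_vector \<Rightarrow> real"
  assumes "open S" and h: "bounded_linear h"
    and closed: "\<And>f. f \<in> \<F> \<Longrightarrow> \<exists>f'\<in>\<F>. \<forall>x\<in>S. (f has_real_derivative f' x) (at x)"
    and "f \<in> \<F>"
  shows "Ck_on n (h -` S) (\<lambda>q. complex_of_real (c * f (h q)))"
  using \<open>f \<in> \<F>\<close>
proof (induction n arbitrary: f c)
  case 0
  obtain f' where "\<forall>x\<in>S. (f has_real_derivative f' x) (at x)" using closed[OF 0] by blast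
  then have "continuous_on S f" by (meson DERIV_continuous_on has_field_derivative_at_within)
  moreover have "continuous_on (h -` S) h" using h by (simp add: linear_continuous_on)
  ultimately have "continuous_on (h -` S) (\<lambda>q. f (h q))"
    by (rule continuous_on_compose2) auto
  then show ?case by (auto intro!: continuous_intros)
next
  case (Suc n)
  obtain f' where f': "f' \<in> \<F>" "\<And>x. x \<in> S \<Longrightarrow> (f has_real_derivative f' x) (at x)"
    using closed[OF Suc.prems] by blast
  have op: "open (h -` S)"
    using \<open>open S\<close> h by (intro continuous_open_vimage) (auto intro: linear_continuous_at)
  have der: "((\<lambda>q. complex_of_real (c * f (h q))) has_derivative
        (\<lambda>v. complex_of_real (c * h v * f' (h q)))) (at q)" if "q \<in> h -` S" for q
  proof -
    have "((\<lambda>q. f (h q)) has_derivative (\<lambda>v. f' (h q) * h v)) (at q)"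
      using has_derivative_compose[OF bounded_linear_imp_has_derivative[OF h], of f "\<lambda>v. f' (h q) * v" q UNIV]
        f'(2)[of "h q"] that by (simp add: has_field_derivative_def mult_commute_abs)
    then have "((\<lambda>q. complex_of_real (c * f (h q))) has_derivative
        (\<lambda>v. complex_of_real (c * (f' (h q) * h v)))) (at q)"
      by (intro has_derivative_of_real has_derivative_mult_right)
    then show ?thesis by (simp add: mult_ac)
  qed
  have "Ck_on n (h -` S) (\<lambda>x. frechet_derivative (\<lambda>q. complex_of_real (c * f (h q))) (at x) v)" for v
  proof (rule Ck_on_cong[OF op])
    show "Ck_on n (h -` S) (\<lambda>q. complex_of_real ((c * h v) * f' (h q)))"
      by (rule Suc.IH[OF f'(1)])
    fix x assume "x \<in> h -` S"
    then show "complex_of_real (c * h v * f' (h x)) =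
        frechet_derivative (\<lambda>q. complex_of_real (c * f (h q))) (at x) v"
      using frechet_derivative_at[OF der] by metis
  qed
  moreover have "(\<lambda>q. complex_of_real (c * f (h q))) differentiable_on (h -` S)"
    using der op by (auto simp: differentiable_on_eq_differentiable_at differentiable_def)
  ultimately show ?case by simp
qed

subsection \<open>Power series at a regular singular point\<close>

unbundle no vec_syntax
unbundle fps_syntax

text \<open>Normalised solution, regular at \<open>0\<close>, of \<open>t \<alpha> P'' + \<gamma> P' + \<delta> P = 0\<close> with \<open>\<alpha>(0) = \<gamma>(0) = 2\<close>;
  the indicial equation is then \<open>2 n\<^sup>2 = 0\<close>.\<close>

fun frobenius_coeff :: "real fps \<Rightarrow> real fps \<Rightarrow> real fps \<Rightarrow> nat \<Rightarrow> real" where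
  "frobenius_coeff \<alpha> \<gamma> \<delta> 0 = 1"
| "frobenius_coeff \<alpha> \<gamma> \<delta> (Suc n) =
     - ((\<Sum>i=1..n. (\<alpha> $ i * real (n - i) + \<gamma> $ i) * real (n - i + 1) * frobenius_coeff \<alpha> \<gamma> \<delta> (n - i + 1))
        + (\<Sum>i=0..n. \<delta> $ i * frobenius_coeff \<alpha> \<gamma> \<delta> (n - i))) / (2 * (real n + 1)\<^sup>2)"

declare frobenius_coeff.simps(2) [simp del]

definition frobenius_fps :: "real fps \<Rightarrow> real fps \<Rightarrow> real fps \<Rightarrow> real fps" where
  "frobenius_fps \<alpha> \<gamma> \<delta> = Abs_fps (frobenius_coeff \<alpha> \<gamma> \<delta>)"

text \<open>Coefficient comparison: \<open>frobenius_coeff\<close> is the recursion obtained by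
  setting the n-th coefficient of the left-hand side to zero.\<close>

lemma frobenius_fps_ode:
  fixes \<alpha> \<gamma> \<delta> :: "real fps"
  assumes "\<alpha> $ 0 = 2" "\<gamma> $ 0 = 2"
  defines "P \<equiv> frobenius_fps \<alpha> \<gamma> \<delta>"
  shows "\<alpha> * (fps_X * fps_deriv (fps_deriv P)) + \<gamma> * fps_deriv P + \<delta> * P = 0"
proof (rule fps_ext)
  fix n
  let ?a = "frobenius_coeff \<alpha> \<gamma> \<delta>"
  let ?t = "\<lambda>i. (\<alpha> $ i * real (n - i) + \<gamma> $ i) * real (n - i + 1) * ?a (n - i + 1)"
  have X: "(fps_X * fps_deriv (fps_deriv P)) $ k = real k * real (k + 1) * ?a (k + 1)" for k
    by (cases k) (simp_all add: P_def frobenius_fps_def mult_ac)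
  have "(\<alpha> * (fps_X * fps_deriv (fps_deriv P)) + \<gamma> * fps_deriv P + \<delta> * P) $ n
     = (\<Sum>i=0..n. \<alpha> $ i * (real (n - i) * real (n - i + 1) * ?a (n - i + 1)))
      + (\<Sum>i=0..n. \<gamma> $ i * (real (n - i + 1) * ?a (n - i + 1))) + (\<Sum>i=0..n. \<delta> $ i * ?a (n - i))"
    by (simp only: fps_add_nth fps_mult_nth[of \<alpha>] fps_mult_nth[of \<gamma>] fps_mult_nth[of \<delta>] X)
       (simp add: P_def frobenius_fps_def)
  also have "\<dots> = (\<Sum>i=0..n. ?t i) + (\<Sum>i=0..n. \<delta> $ i * ?a (n - i))"
    by (simp add: sum.distrib[symmetric] algebra_simps)
  \<comment> \<open>Only the term i = 0 contains \<open>?a (Suc n)\<close>. Its factor (2 n + 2) (n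
    + 1) is never zero, so the recursion meets no resonance.\<close>
  also have "(\<Sum>i=0..n. ?t i) = 2 * (real n + 1)\<^sup>2 * ?a (Suc n) + (\<Sum>i=1..n. ?t i)"
    using assms by (subst sum.atLeast_Suc_atMost) (simp_all add: power2_eq_square algebra_simps)
  also have "2 * (real n + 1)\<^sup>2 * ?a (Suc n) = - ((\<Sum>i=1..n. ?t i) + (\<Sum>i=0..n. \<delta> $ i * ?a (n - i)))"
  proof -
    have "(real n + 1)\<^sup>2 \<noteq> 0" by simp
    then show ?thesis unfolding frobenius_coeff.simps by (simp add: field_simps)
  qed
  finally show "(\<alpha> * (fps_X * fps_deriv (fps_deriv P)) + \<gamma> * fps_deriv P + \<delta> * P) $ n = 0 $ n" by simp
qed

text \<open>Each new coefficient involves all earlier ones, so the induction runs on the partial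
  sums \<open>?S n\<close> of absolute values. The factors in the recursion grow at most like C (n +
  1)^2, which the divisor 2 (n + 1)^2 cancels; hence a new coefficient is at most C times
  \<open>?S n\<close>, and \<open>?S\<close> grows by at most 1 + C per step.\<close>

lemma frobenius_coeff_bound:
  assumes C: "\<And>n. \<bar>\<alpha> $ n\<bar> \<le> C" "\<And>n. \<bar>\<gamma> $ n\<bar> \<le> C" "\<And>n. \<bar>\<delta> $ n\<bar> \<le> C"
  shows "\<bar>frobenius_coeff \<alpha> \<gamma> \<delta> n\<bar> \<le> (1 + C) ^ n"
proof -
  let ?a = "frobenius_coeff \<alpha> \<gamma> \<delta>"
  let ?S = "\<lambda>n. \<Sum>k\<le>n. \<bar>?a k\<bar>"
  have C0: "0 \<le> C" using C(1)[of 0] by linarith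
  have step: "\<bar>?a (Suc n)\<bar> \<le> C * ?S n" for n
  proof -
    let ?N = "(real n + 1)\<^sup>2"
    have N: "?N \<ge> 1" by simp
    have b1: "\<bar>(\<alpha> $ i * real (n - i) + \<gamma> $ i) * real (n - i + 1)\<bar> \<le> C * ?N" if "i \<in> {1..n}" for i
    proof -
      have "\<bar>\<alpha> $ i * real (n - i) + \<gamma> $ i\<bar> \<le> \<bar>\<alpha> $ i * real (n - i)\<bar> + \<bar>\<gamma> $ i\<bar>" by (rule abs_triangle_ineq)
      also have "\<dots> \<le> C * real (n - i) + C"
        using C by (simp add: abs_mult add_mono mult_right_mono)
      also have "\<dots> \<le> C * (real n + 1)"
        using C0 by (simp add: algebra_simps mult_left_mono)
      finally have "\<bar>\<alpha> $ i * real (n - i) + \<gamma> $ i\<bar> \<le> C * (real n + 1)" .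
      then have "\<bar>\<alpha> $ i * real (n - i) + \<gamma> $ i\<bar> * real (n - i + 1) \<le> C * (real n + 1) * (real n + 1)"
        using C0 by (intro mult_mono) auto
      then show ?thesis by (simp add: abs_mult power2_eq_square mult_ac)
    qed
    have "\<bar>\<Sum>i=1..n. (\<alpha> $ i * real (n - i) + \<gamma> $ i) * real (n - i + 1) * ?a (n - i + 1)\<bar>
        \<le> (\<Sum>i=1..n. C * ?N * \<bar>?a (n - i + 1)\<bar>)"
      by (rule order_trans[OF sum_abs], rule sum_mono, subst abs_mult, rule mult_right_mono[OF b1]) auto
    also have "\<dots> = C * ?N * (\<Sum>i=1..n. \<bar>?a (n - i + 1)\<bar>)"
      by (simp add: sum_distrib_left)
    also have "(\<Sum>i=1..n. \<bar>?a (n - i + 1)\<bar>) = (\<Sum>k=1..n. \<bar>?a k\<bar>)"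
      by (rule sum.reindex_bij_witness[of _ "\<lambda>k. n - k + 1" "\<lambda>k. n - k + 1"]) auto
    also have "\<dots> \<le> ?S n" by (rule sum_mono2) auto
    finally have 1: "\<bar>\<Sum>i=1..n. (\<alpha> $ i * real (n - i) + \<gamma> $ i) * real (n - i + 1) * ?a (n - i + 1)\<bar>
        \<le> C * ?N * ?S n" using C0 by (simp add: mult_left_mono)
    have "\<bar>\<Sum>i=0..n. \<delta> $ i * ?a (n - i)\<bar> \<le> (\<Sum>i=0..n. C * \<bar>?a (n - i)\<bar>)"
      by (rule order_trans[OF sum_abs], rule sum_mono, subst abs_mult, rule mult_right_mono[OF C(3)]) auto
    also have "\<dots> = C * (\<Sum>i=0..n. \<bar>?a (n - i)\<bar>)"
      by (simp add: sum_distrib_left)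
    also have "(\<Sum>i=0..n. \<bar>?a (n - i)\<bar>) = ?S n"
      by (rule sum.reindex_bij_witness[of _ "\<lambda>k. n - k" "\<lambda>k. n - k"]) auto
    \<comment> \<open>The second sum has no quadratic growth; it is enlarged by \<open>?N\<close> so
      that both halves share the factor cancelled by \<open>2 * ?N\<close>.\<close>
    also have "C * ?S n \<le> ?N * (C * ?S n)"
      using mult_right_mono[OF N, of "C * ?S n"] C0 by (simp add: sum_nonneg)
    finally have 2: "\<bar>\<Sum>i=0..n. \<delta> $ i * ?a (n - i)\<bar> \<le> C * ?N * ?S n" by (simp add: mult_ac)
    have "\<bar>?a (Suc n)\<bar> * (2 * ?N) =
       \<bar>(\<Sum>i=1..n. (\<alpha> $ i * real (n - i) + \<gamma> $ i) * real (n - i + 1) * ?a (n - i + 1))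
        + (\<Sum>i=0..n. \<delta> $ i * ?a (n - i))\<bar>"
    proof -
      have "(real n + 1)\<^sup>2 \<noteq> 0" by simp
      then show ?thesis unfolding frobenius_coeff.simps abs_divide abs_minus_cancel by simp
    qed
    also have "\<dots> \<le> C * ?S n * (2 * ?N)" using 1 2 by (simp add: algebra_simps)
    finally show ?thesis by (rule mult_right_le_imp_le) simp
  qed
  have "?S n \<le> (1 + C) ^ n"
  proof (induction n)
    case (Suc n)
    have "?S (Suc n) \<le> (1 + C) * ?S n" using step[of n] by (simp add: algebra_simps)
    also have "\<dots> \<le> (1 + C) * (1 + C) ^ n" using Suc C0 by (simp add: mult_left_mono)
    finally show ?case by simp
  qed simp
  moreover have "\<bar>?a n\<bar> \<le> ?S n" by (rule member_le_sum) auto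
  ultimately show ?thesis by linarith
qed

lemma frobenius_fps_conv_radius:
  assumes C: "\<And>n. \<bar>\<alpha> $ n\<bar> \<le> C" "\<And>n. \<bar>\<gamma> $ n\<bar> \<le> C" "\<And>n. \<bar>\<delta> $ n\<bar> \<le> C"
  shows "fps_conv_radius (frobenius_fps \<alpha> \<gamma> \<delta>) \<ge> ereal (1 / (1 + C))"
  unfolding fps_conv_radius_def
proof (rule conv_radius_geI_ex')
  have C0: "0 \<le> C" using C(1)[of 0] by linarith
  fix r :: real assume r: "0 < r" "ereal r < ereal (1 / (1 + C))"
  have q: "\<bar>(1 + C) * r\<bar> < 1" using r C0 by (simp add: field_simps)
  show "summable (\<lambda>n. frobenius_fps \<alpha> \<gamma> \<delta> $ n * of_real r ^ n)"
  proof (rule summable_comparison_test')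
    show "summable (\<lambda>n. ((1 + C) * r) ^ n)" using q by (simp add: summable_geometric_iff)
    show "norm (frobenius_fps \<alpha> \<gamma> \<delta> $ n * of_real r ^ n) \<le> ((1 + C) * r) ^ n" if "n \<ge> 0" for n
      using frobenius_coeff_bound[of \<alpha> C \<gamma> \<delta>, OF C, of n] r
      by (simp add: frobenius_fps_def abs_mult power_mult_distrib mult_right_mono)
  qed
qed

text \<open>Polynomials have bounded coefficients, so the geometric bound gives a positive radius,
  inside which the formal identity may be evaluated. The radius is crude, but a small disc around
  each pole is enough: away from the poles smoothness comes from the equation, in
  \<open>Ck_on_poly_ode\<close>.\<close>

lemma frobenius_solution:
  fixes a c d :: "real poly"
  assumes "coeff a 0 = 2" "coeff c 0 = 2"
  obtains P :: "real fps" and r :: real where "0 < r" "ereal r \<le> fps_conv_radius P" "P $ 0 = 1"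
    "\<And>t. \<bar>t\<bar> < r \<Longrightarrow> t * poly a t * eval_fps (fps_deriv (fps_deriv P)) t
        + poly c t * eval_fps (fps_deriv P) t + poly d t * eval_fps P t = 0"
proof -
  let ?a = "fps_of_poly a" and ?c = "fps_of_poly c" and ?d = "fps_of_poly d"
  define P where "P = frobenius_fps ?a ?c ?d"
  have bdd: "\<exists>C. \<forall>n. \<bar>fps_of_poly p $ n\<bar> \<le> C" for p :: "real poly"
  proof -
    have "\<bar>coeff p n\<bar> \<le> (\<Sum>i\<le>degree p. \<bar>coeff p i\<bar>)" for n
    proof (cases "n \<le> degree p")
      case True
      then show ?thesis by (intro member_le_sum) auto
    next
      case False
      then show ?thesis by (simp add: coeff_eq_0 sum_nonneg)
    qed
    then show ?thesis by auto
  qed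
  obtain Ca Cc Cd where C: "\<And>n. \<bar>?a $ n\<bar> \<le> Ca" "\<And>n. \<bar>?c $ n\<bar> \<le> Cc" "\<And>n. \<bar>?d $ n\<bar> \<le> Cd"
    using bdd[of a] bdd[of c] bdd[of d] by auto
  define C where "C = max Ca (max Cc Cd)"
  have CC: "\<bar>?a $ n\<bar> \<le> C" "\<bar>?c $ n\<bar> \<le> C" "\<bar>?d $ n\<bar> \<le> C" for n
    using C(1-3)[of n] by (auto simp: C_def)
  define r where "r = 1 / (1 + C)"
  have "0 \<le> C" using CC(1)[of 0] by linarith
  then have r: "0 < r" by (simp add: r_def)
  have rad: "ereal r \<le> fps_conv_radius P"
    unfolding P_def r_def by (rule frobenius_fps_conv_radius[OF CC])
  have rad1: "ereal r \<le> fps_conv_radius (fps_deriv P)" using rad fps_conv_radius_deriv order_trans by blast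
  have rad2: "ereal r \<le> fps_conv_radius (fps_deriv (fps_deriv P))" using rad1 fps_conv_radius_deriv order_trans by blast
  have ode: "?a * (fps_X * fps_deriv (fps_deriv P)) + ?c * fps_deriv P + ?d * P = 0"
    unfolding P_def using assms by (intro frobenius_fps_ode) auto
  show ?thesis
  proof (rule that[OF r rad])
    show "P $ 0 = 1" by (simp add: P_def frobenius_fps_def)
    fix t :: real assume t: "\<bar>t\<bar> < r"
    have lt: "ereal (norm t) < fps_conv_radius Q" if "ereal r \<le> fps_conv_radius Q" for Q :: "real fps"
      using t that by (metis ereal_less_eq(3) less_ereal.simps(1) order_less_le_trans real_norm_def)
    have m: "ereal r \<le> fps_conv_radius (A * B)" if "ereal r \<le> fps_conv_radius A" "ereal r \<le> fps_conv_radius B"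
      for A B :: "real fps"
      using that fps_conv_radius_mult[of A B] by (meson min.boundedI order_trans)
    have p: "ereal r \<le> fps_conv_radius (fps_of_poly q)" for q :: "real poly" by simp
    have X: "ereal r \<le> fps_conv_radius (fps_X :: real fps)" by simp
    have s: "ereal r \<le> fps_conv_radius (A + B)" if "ereal r \<le> fps_conv_radius A" "ereal r \<le> fps_conv_radius B"
      for A B :: "real fps"
      using that fps_conv_radius_add[of A B] by (meson min.boundedI order_trans)
    note X2 = m[OF X rad2]
    note A1 = m[OF p[of a] X2] and A2 = m[OF p[of c] rad1] and A3 = m[OF p[of d] rad]
    have "eval_fps (?a * (fps_X * fps_deriv (fps_deriv P)) + ?c * fps_deriv P + ?d * P) t
      = poly a t * (t * eval_fps (fps_deriv (fps_deriv P)) t)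
        + poly c t * eval_fps (fps_deriv P) t + poly d t * eval_fps P t"
      unfolding eval_fps_add[OF lt[OF s[OF A1 A2]] lt[OF A3]] eval_fps_add[OF lt[OF A1] lt[OF A2]]
        eval_fps_mult[OF lt[OF p] lt[OF X2]] eval_fps_mult[OF lt[OF p] lt[OF rad1]]
        eval_fps_mult[OF lt[OF p] lt[OF rad]] eval_fps_mult[OF lt[OF X] lt[OF rad2]]
      by simp
    then show "t * poly a t * eval_fps (fps_deriv (fps_deriv P)) t
        + poly c t * eval_fps (fps_deriv P) t + poly d t * eval_fps P t = 0"
      unfolding ode by (simp add: mult_ac)
  qed
qed

section \<open>Comparison of two solutions, and smoothness bootstrapped from equations and
  series\<close>

lemma DERIV_zero_const_greaterThanLessThan:
  fixes f :: "real \<Rightarrow> real"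
  assumes "\<And>x. x \<in> {lo<..<hi} \<Longrightarrow> (f has_real_derivative 0) (at x)"
  shows "\<exists>k. \<forall>x\<in>{lo<..<hi}. f x = k"
  using has_field_derivative_zero_constant[of "{lo<..<hi}" f] assms
  by (metis convex_real_interval(8) has_field_derivative_at_within)

text \<open>\<open>M\<close> is the integrating factor of the equation, so \<open>M (f g' - f' g)\<close> is constant, and the limits
  at \<open>0\<close> force this constant to vanish.\<close>

lemma wronskian_proportional:
  fixes f f1 f2 g g1 g2 a c d M M' :: "real \<Rightarrow> real"
  assumes r: "0 < r"
    and df: "\<And>t. t \<in> {0<..<r} \<Longrightarrow> (f has_real_derivative f1 t) (at t)"
      "\<And>t. t \<in> {0<..<r} \<Longrightarrow> (f1 has_real_derivative f2 t) (at t)"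
    and dg: "\<And>t. t \<in> {0<..<r} \<Longrightarrow> (g has_real_derivative g1 t) (at t)"
      "\<And>t. t \<in> {0<..<r} \<Longrightarrow> (g1 has_real_derivative g2 t) (at t)"
    and odef: "\<And>t. t \<in> {0<..<r} \<Longrightarrow> a t * f2 t + c t * f1 t + d t * f t = 0"
    and odeg: "\<And>t. t \<in> {0<..<r} \<Longrightarrow> a t * g2 t + c t * g1 t + d t * g t = 0"
    and a: "\<And>t. t \<in> {0<..<r} \<Longrightarrow> a t \<noteq> 0"
    and M: "\<And>t. t \<in> {0<..<r} \<Longrightarrow> (M has_real_derivative M' t) (at t)"
      "\<And>t. t \<in> {0<..<r} \<Longrightarrow> a t * M' t = c t * M t" "\<And>t. t \<in> {0<..<r} \<Longrightarrow> M t \<noteq> 0"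
    and lim: "((\<lambda>t. M t * f t) \<longlongrightarrow> 0) (at_right 0)" "((\<lambda>t. M t * f1 t) \<longlongrightarrow> 0) (at_right 0)"
      "(g \<longlongrightarrow> l) (at_right 0)" "(g1 \<longlongrightarrow> l') (at_right 0)"
    and g: "\<And>t. t \<in> {0<..<r} \<Longrightarrow> g t \<noteq> 0"
  obtains k where "\<And>t. t \<in> {0<..<r} \<Longrightarrow> f t = k * g t"
proof -
  define W where "W = (\<lambda>t. M t * f t * g1 t - M t * f1 t * g t)"
  have "(W has_real_derivative 0) (at t)" if t: "t \<in> {0<..<r}" for t
  proof -
    have "(W has_real_derivative M' t * (f t * g1 t - f1 t * g t) + M t * (f t * g2 t - f2 t * g t)) (at t)"
      unfolding W_def
      by (rule derivative_eq_intros df dg M t refl)+ (simp add: algebra_simps)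
    \<comment> \<open>Multiplying by \<open>a t\<close> allows both equations to be inserted: the
      terms with \<open>d\<close> cancel each other, those with \<open>c\<close> cancel against
      \<open>a t * M' t\<close>.\<close>
    moreover have "a t * (M' t * (f t * g1 t - f1 t * g t) + M t * (f t * g2 t - f2 t * g t)) = 0"
    proof -
      have "a t * (M' t * (f t * g1 t - f1 t * g t) + M t * (f t * g2 t - f2 t * g t))
        = (a t * M' t) * (f t * g1 t - f1 t * g t) + M t * (f t * (a t * g2 t) - (a t * f2 t) * g t)"
        by (simp add: algebra_simps)
      also have "a t * g2 t = - c t * g1 t - d t * g t" using odeg[OF t] by linarith
      also have "a t * f2 t = - c t * f1 t - d t * f t" using odef[OF t] by linarith
      finally show ?thesis unfolding M(2)[OF t] by (simp add: algebra_simps)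
    qed
    ultimately show ?thesis using a[OF t] by simp
  qed
  then obtain w where w: "\<And>t. t \<in> {0<..<r} \<Longrightarrow> W t = w"
    using DERIV_zero_const_greaterThanLessThan[of 0 r W] by blast
  have ev: "eventually (\<lambda>t. t \<in> {0<..<r}) (at_right 0)" using r eventually_at_right_real by blast
  have "(W \<longlongrightarrow> 0 * l' - 0 * l) (at_right 0)"
    unfolding W_def by (intro tendsto_intros lim)
  moreover have "(W \<longlongrightarrow> w) (at_right 0)"
    by (rule tendsto_eventually) (rule eventually_mono[OF ev w])
  ultimately have "w = 0" using tendsto_unique[OF trivial_limit_at_right_real] by fastforce
  then have W0: "f t * g1 t = f1 t * g t" if "t \<in> {0<..<r}" for t
    using w[OF that] M(3)[OF that] by (auto simp: W_def)
  \<comment> \<open>A vanishing Wronskian gives proportionality only where \<open>g\<close> has no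
    zero; \<open>pole_series\<close> shrinks its radius for this purpose.\<close>
  have "((\<lambda>t. f t / g t) has_real_derivative 0) (at t)" if t: "t \<in> {0<..<r}" for t
    using W0[OF t] g[OF t] DERIV_divide[OF df(1)[OF t] dg(1)[OF t] g[OF t]] by simp
  then obtain k where k: "\<And>t. t \<in> {0<..<r} \<Longrightarrow> f t / g t = k"
    using DERIV_zero_const_greaterThanLessThan[of 0 r "\<lambda>t. f t / g t"] by blast
  show ?thesis by (rule that[of k]) (use k g in \<open>force simp: field_simps\<close>)
qed

text \<open>Although only two derivatives of \<open>K\<close> are given, the functions (p K + q K1)
  / w^k with polynomials p, q form a family closed under differentiation, since the equation
  replaces \<open>w * K2\<close> by a combination of \<open>K1\<close> and \<open>K\<close>.\<close>

lemma Ck_on_poly_ode: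
  fixes h :: "'a::real_normed_vector \<Rightarrow> real" and K K1 K2 :: "real \<Rightarrow> real"
  assumes "open S" "bounded_linear h"
    and K: "\<And>s. s \<in> S \<Longrightarrow> (K has_real_derivative K1 s) (at s)"
    and K1: "\<And>s. s \<in> S \<Longrightarrow> (K1 has_real_derivative K2 s) (at s)"
    and ode: "\<And>s. s \<in> S \<Longrightarrow> poly w s * K2 s = poly u s * K1 s + poly v s * K s"
    and w: "\<And>s. s \<in> S \<Longrightarrow> poly w s \<noteq> 0"
  shows "Ck_on n (h -` S) (\<lambda>q. complex_of_real (K (h q)))"
proof -
  define G where "G = (\<lambda>(p, q, k) s. (poly p s * K s + poly q s * K1 s) / poly w s ^ k)"
  have "\<exists>f'\<in>range G. \<forall>s\<in>S. (f has_real_derivative f' s) (at s)" if "f \<in> range G" for f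
  proof -
    from that obtain z where "f = G z" by blast
    then obtain p q k where f: "f = (\<lambda>s. (poly p s * K s + poly q s * K1 s) / poly w s ^ k)"
      by (cases z) (simp add: G_def)
    \<comment> \<open>Coefficients of \<open>K\<close> and \<open>K1\<close> in the numerator of the
      quotient rule, after one extra factor \<open>w\<close> has been used to eliminate
      \<open>K2\<close>.\<close>
    define p' where "p' = pderiv p * w + q * v - of_nat k * pderiv w * p"
    define q' where "q' = (p + pderiv q) * w + q * u - of_nat k * pderiv w * q"
    have "(f has_real_derivative G (p', q', Suc k) s) (at s)" if s: "s \<in> S" for s
    proof -
      let ?W = "poly w s" and ?N = "poly p s * K s + poly q s * K1 s"
      define N' where "N' = poly (pderiv p) s * K s + poly p s * K1 s + poly (pderiv q) s * K1 s + poly q s * K2 s"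
      have N: "((\<lambda>s. poly p s * K s + poly q s * K1 s) has_real_derivative N') (at s)"
        unfolding N'_def by (rule derivative_eq_intros K K1 s poly_DERIV refl)+ (simp add: algebra_simps)
      \<comment> \<open>For k = 0 the exponent \<open>k - 1\<close> truncates to 0, which is
        harmless because the factor \<open>of_nat k\<close> vanishes.\<close>
      have Wk: "((\<lambda>s. poly w s ^ k) has_real_derivative of_nat k * ?W ^ (k - 1) * poly (pderiv w) s) (at s)"
        by (rule derivative_eq_intros poly_DERIV refl)+ simp
      have "(f has_real_derivative (N' * ?W ^ k - ?N * (of_nat k * ?W ^ (k - 1) * poly (pderiv w) s)) / (?W ^ k * ?W ^ k)) (at s)"
        unfolding f using DERIV_divide[OF N Wk] w[OF s] by simp
      moreover have "(N' * ?W ^ k - ?N * (of_nat k * ?W ^ (k - 1) * poly (pderiv w) s)) / (?W ^ k * ?W ^ k)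
          = (N' * ?W - ?N * of_nat k * poly (pderiv w) s) / ?W ^ Suc k"
        using w[OF s] by (cases k) (simp_all add: field_simps)
      moreover have "N' * ?W - ?N * of_nat k * poly (pderiv w) s = poly p' s * K s + poly q' s * K1 s"
      proof -
        have "N' * ?W = (poly (pderiv p) s * K s + poly p s * K1 s + poly (pderiv q) s * K1 s) * ?W + poly q s * (?W * K2 s)"
          by (simp add: N'_def algebra_simps)
        then show ?thesis unfolding ode[OF s] p'_def q'_def by (simp add: algebra_simps)
      qed
      ultimately show ?thesis by (simp add: G_def)
    qed
    then show ?thesis by blast
  qed
  moreover have "K = G (1, 0, 0)" by (simp add: G_def)
  then have "K \<in> range G" by blast
  ultimately have "Ck_on n (h -` S) (\<lambda>q. complex_of_real (1 * K (h q)))"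
    by (intro Ck_on_derivative_closed_family[OF assms(1,2)])
  then show ?thesis by simp
qed

text \<open>The closed family here consists of scaled power series in 1 - \<sigma> s, the height
  below the pole s = \<sigma> for \<sigma> = 1 or -1. Formal differentiation does not shrink the
  radius, and the scalar collects the factors -\<sigma>.\<close>

lemma Ck_on_eval_fps:
  fixes h :: "'a::real_normed_vector \<Rightarrow> real" and P :: "real fps"
  assumes "bounded_linear h" and rad: "ereal r \<le> fps_conv_radius P"
  shows "Ck_on n (h -` {s. \<bar>1 - \<sigma> * s\<bar> < r}) (\<lambda>q. complex_of_real (k * eval_fps P (1 - \<sigma> * h q)))"
proof -
  define F where "F = {f. \<exists>Q c. ereal r \<le> fps_conv_radius Q \<and> f = (\<lambda>s. c * eval_fps Q (1 - \<sigma> * s))}"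
  have "open {s. \<bar>1 - \<sigma> * s\<bar> < r}" by (intro open_Collect_less continuous_intros)
  moreover have "\<exists>f'\<in>F. \<forall>s\<in>{s. \<bar>1 - \<sigma> * s\<bar> < r}. (f has_real_derivative f' s) (at s)" if "f \<in> F" for f
  proof -
    from that obtain Q c where Q: "ereal r \<le> fps_conv_radius Q" and f: "f = (\<lambda>s. c * eval_fps Q (1 - \<sigma> * s))"
      unfolding F_def by blast
    have "(f has_real_derivative (- c * \<sigma>) * eval_fps (fps_deriv Q) (1 - \<sigma> * s)) (at s)" if "\<bar>1 - \<sigma> * s\<bar> < r" for s
    proof -
      have "ereal (norm (1 - \<sigma> * s)) < fps_conv_radius Q"
        using Q that by (metis less_ereal.simps(1) order_less_le_trans real_norm_def)
      note d = has_field_derivative_eval_fps[OF this, of UNIV]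
      have l: "((\<lambda>s. 1 - \<sigma> * s) has_real_derivative - \<sigma>) (at s)" by (auto intro!: derivative_eq_intros)
      show ?thesis
        unfolding f using DERIV_cmult[OF DERIV_chain2[OF d l], of c] by (simp add: mult_ac)
    qed
    then have "\<forall>s\<in>{s. \<bar>1 - \<sigma> * s\<bar> < r}.
        (f has_real_derivative (- c * \<sigma>) * eval_fps (fps_deriv Q) (1 - \<sigma> * s)) (at s)"
      by simp
    moreover have "ereal r \<le> fps_conv_radius (fps_deriv Q)" using Q fps_conv_radius_deriv order_trans by blast
    then have "(\<lambda>s. (- c * \<sigma>) * eval_fps (fps_deriv Q) (1 - \<sigma> * s)) \<in> F" unfolding F_def by blast
    ultimately show ?thesis by (rule rev_bexI[rotated])
  qed
  moreover have "(\<lambda>s. eval_fps P (1 - \<sigma> * s)) \<in> F"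
  proof -
    have "(\<lambda>s. 1 * eval_fps P (1 - \<sigma> * s)) \<in> F" unfolding F_def using rad by blast
    then show ?thesis by simp
  qed
  ultimately show ?thesis
    by (rule Ck_on_derivative_closed_family[OF _ assms(1)])
qed

subsection \<open>Separation of variables for the Laplace--Beltrami operator\<close>

abbreviation (input) latitudes :: "real set" where
  "latitudes \<equiv> {- pi / 2<..<pi / 2}"

lemma cos_latitude_pos: "\<theta> \<in> latitudes \<Longrightarrow> cos \<theta> > 0"
  by (rule cos_gt_zero_pi) auto

lemma rho_square_pos:
  fixes b \<theta> :: real
  assumes "0 < b"
  shows "0 < (sin \<theta>)\<^sup>2 + b\<^sup>2 * (cos \<theta>)\<^sup>2"
proof (cases "cos \<theta> = 0")
  case True
  then show ?thesis using sin_cos_squared_add[of \<theta>] by simp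
next
  case False
  then show ?thesis using assms by (intro add_nonneg_pos) auto
qed

lemma rho_pos: "0 < b \<Longrightarrow> 0 < rho b \<theta>"
  by (simp add: rho_def rho_square_pos)

lemma rho_square: "(rho b \<theta>)\<^sup>2 = (sin \<theta>)\<^sup>2 + b\<^sup>2 * (cos \<theta>)\<^sup>2"
  by (simp add: rho_def)

lemma rho_has_derivative:
  assumes "0 < b"
  shows "(rho b has_real_derivative (1 - b\<^sup>2) * sin \<theta> * cos \<theta> / rho b \<theta>) (at \<theta>)"
proof -
  have alg: "inverse X / 2 * (2 * \<beta> * s * c) = \<beta> * s * c / X" for X \<beta> s c :: real
    by (simp add: field_simps)
  have "((\<lambda>x. (sin x)\<^sup>2 + b\<^sup>2 * (cos x)\<^sup>2) has_real_derivative 2 * (1 - b\<^sup>2) * sin \<theta> * cos \<theta>) (at \<theta>)"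
    by (rule derivative_eq_intros refl)+ (simp add: algebra_simps)
  from DERIV_chain2[where f = sqrt and g = "\<lambda>x. (sin x)\<^sup>2 + b\<^sup>2 * (cos x)\<^sup>2" and x = \<theta>,
      OF DERIV_real_sqrt[OF rho_square_pos[OF assms]] this]
  show ?thesis unfolding rho_def[abs_def] alg .
qed

text \<open>\<open>\<Delta>u = u'' / \<rho>\<^sup>2 + drift u'\<close> for a zonal \<open>u\<close>.\<close>

definition drift :: "real \<Rightarrow> real \<Rightarrow> real" where
  "drift b \<theta> = - (sin \<theta> * inverse (cos \<theta>)) * (inverse (rho b \<theta>))\<^sup>2
     - (1 - b\<^sup>2) * sin \<theta> * cos \<theta> * (inverse (rho b \<theta>)) ^ 4"

text \<open>This is the origin of \<open>drift\<close>: the derivative of the weight in the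
  divergence form of \<open>LB\<close>, divided by the prefactor cos \<theta> times \<rho>, is the
  coefficient of the first derivative.\<close>

lemma weight_has_derivative:
  assumes "0 < b" "\<theta> \<in> latitudes"
  shows "((\<lambda>x. cos x / rho b x) has_real_derivative (cos \<theta> * rho b \<theta> * drift b \<theta>)) (at \<theta>)"
proof -
  have "rho b \<theta> \<noteq> 0" "cos \<theta> \<noteq> 0" using rho_pos assms cos_latitude_pos by (metis less_irrefl)+
  then have alg: "(- s * r - c * (\<beta> * s * c / r)) / (r * r)
      = c * r * (- (s * inverse c) * (inverse r)\<^sup>2 - \<beta> * s * c * (inverse r) ^ 4)"
    if "c = cos \<theta>" "r = rho b \<theta>" for c r s \<beta>
    using that by (simp add: divide_simps power2_eq_square power4_eq_xxxx)
  show ?thesis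
    unfolding drift_def
    using DERIV_divide[OF DERIV_cos rho_has_derivative[OF assms(1)] \<open>rho b \<theta> \<noteq> 0\<close>]
    by (subst alg[OF refl refl, symmetric]) simp
qed

text \<open>Derivatives are carried explicitly, since \<^const>\<open>vector_derivative\<close> is unspecified where a function
  is not differentiable.\<close>

definition C2_data :: "(real \<Rightarrow> 'a::real_normed_vector) \<Rightarrow> (real \<Rightarrow> 'a) \<Rightarrow> (real \<Rightarrow> 'a) \<Rightarrow> bool" where
  "C2_data u u' u'' \<longleftrightarrow> (\<forall>x\<in>latitudes. (u has_vector_derivative u' x) (at x) \<and>
     (u' has_vector_derivative u'' x) (at x))"

definition zonal_LB :: "real \<Rightarrow> (real \<Rightarrow> 'a::real_vector) \<Rightarrow> (real \<Rightarrow> 'a) \<Rightarrow> real \<Rightarrow> 'a" where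
  "zonal_LB b u' u'' \<theta> = (inverse (rho b \<theta>))\<^sup>2 *\<^sub>R u'' \<theta> + drift b \<theta> *\<^sub>R u' \<theta>"

text \<open>One shape for everything that occurs: the stream functions, the eigenfunctions, and with
  \<kappa> = 0 the zonal functions. It is preserved by both partial derivatives and by
  \<open>LB\<close>, so identities on the surface become identities between functions of
  latitude.\<close>

definition modes :: "complex \<Rightarrow> (real \<Rightarrow> complex) \<Rightarrow> (real \<Rightarrow> complex) \<Rightarrow> (real \<Rightarrow> complex) \<Rightarrow> real \<times> real \<Rightarrow> complex" where
  "modes \<kappa> g A B p = g (snd p) + A (snd p) * exp (\<kappa> * of_real (fst p)) + B (snd p) * exp (- \<kappa> * of_real (fst p))"

lemma dphi_modes:
  "dphi (modes \<kappa> g A B) = modes \<kappa> (\<lambda>_. 0) (\<lambda>\<theta>. \<kappa> * A \<theta>) (\<lambda>\<theta>. - \<kappa> * B \<theta>)"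
proof
  fix p
  have "((\<lambda>z. g (snd p) + A (snd p) * exp (\<kappa> * z) + B (snd p) * exp (- \<kappa> * z)) has_field_derivative
      modes \<kappa> (\<lambda>_. 0) (\<lambda>\<theta>. \<kappa> * A \<theta>) (\<lambda>\<theta>. - \<kappa> * B \<theta>) p) (at (of_real (fst p)))"
    by (auto intro!: derivative_eq_intros simp: modes_def)
  from vector_derivative_at[OF has_vector_derivative_real_field[OF this]]
  show "dphi (modes \<kappa> g A B) p = modes \<kappa> (\<lambda>_. 0) (\<lambda>\<theta>. \<kappa> * A \<theta>) (\<lambda>\<theta>. - \<kappa> * B \<theta>) p"
    by (simp add: dphi_def modes_def)
qed

lemma modes_has_derivative_theta:
  assumes "(g has_vector_derivative g') (at \<theta>)" "(A has_vector_derivative A') (at \<theta>)"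
    "(B has_vector_derivative B') (at \<theta>)"
  shows "((\<lambda>t. modes \<kappa> g A B (\<phi>, t)) has_vector_derivative
     modes \<kappa> (\<lambda>_. g') (\<lambda>_. A') (\<lambda>_. B') (\<phi>, \<theta>)) (at \<theta>)"
  unfolding modes_def
  using assms by (auto intro!: derivative_eq_intros)

lemma dtheta_modes:
  assumes "C2_data g g' g''" "C2_data A A' A''" "C2_data B B' B''" "snd p \<in> latitudes"
  shows "dtheta (modes \<kappa> g A B) p = modes \<kappa> g' A' B' p"
proof -
  have "((\<lambda>t. modes \<kappa> g A B (fst p, t)) has_vector_derivative
     modes \<kappa> (\<lambda>_. g' (snd p)) (\<lambda>_. A' (snd p)) (\<lambda>_. B' (snd p)) (fst p, snd p)) (at (snd p))"
    using assms by (intro modes_has_derivative_theta) (auto simp: C2_data_def)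
  then show ?thesis unfolding dtheta_def by (subst vector_derivative_at) (auto simp: modes_def)
qed

lemma LB_modes:
  assumes b: "0 < b"
    and C2: "C2_data g g' g''" "C2_data A A' A''" "C2_data B B' B''" and p: "snd p \<in> latitudes"
  shows "LB b (modes \<kappa> g A B) p =
    modes \<kappa> (zonal_LB b g' g'') (\<lambda>\<theta>. zonal_LB b A' A'' \<theta> + \<kappa>\<^sup>2 * A \<theta> / of_real ((cos \<theta>)\<^sup>2))
      (\<lambda>\<theta>. zonal_LB b B' B'' \<theta> + \<kappa>\<^sup>2 * B \<theta> / of_real ((cos \<theta>)\<^sup>2)) p"
proof -
  obtain \<phi> \<theta> where p_eq: "p = (\<phi>, \<theta>)" by (cases p)
  have \<theta>: "\<theta> \<in> latitudes" using p p_eq by simp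
  have nz: "rho b \<theta> \<noteq> 0" "cos \<theta> \<noteq> 0" using rho_pos[OF b] cos_latitude_pos[OF \<theta>] by (metis less_irrefl)+
  let ?w = "\<lambda>x. cos x / rho b x" and ?w' = "cos \<theta> * rho b \<theta> * drift b \<theta>"
  have "((\<lambda>t. ?w t *\<^sub>R modes \<kappa> g' A' B' (\<phi>, t)) has_vector_derivative
      ?w \<theta> *\<^sub>R modes \<kappa> g'' A'' B'' (\<phi>, \<theta>) + ?w' *\<^sub>R modes \<kappa> g' A' B' (\<phi>, \<theta>)) (at \<theta>)"
  proof (rule has_vector_derivative_scaleR)
    show "(?w has_real_derivative ?w') (at \<theta>)" using weight_has_derivative b \<theta> by blast
    have "((\<lambda>t. modes \<kappa> g' A' B' (\<phi>, t)) has_vector_derivative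
       modes \<kappa> (\<lambda>_. g'' \<theta>) (\<lambda>_. A'' \<theta>) (\<lambda>_. B'' \<theta>) (\<phi>, \<theta>)) (at \<theta>)"
      using C2 \<theta> by (intro modes_has_derivative_theta) (auto simp: C2_data_def)
    then show "((\<lambda>t. modes \<kappa> g' A' B' (\<phi>, t)) has_vector_derivative modes \<kappa> g'' A'' B'' (\<phi>, \<theta>)) (at \<theta>)"
      by (simp add: modes_def)
  qed
  \<comment> \<open>\<open>dtheta\<close> is known only at latitudes; the strip is open, so this
    still determines the next derivative.\<close>
  then have "((\<lambda>t. ?w t *\<^sub>R dtheta (modes \<kappa> g A B) (\<phi>, t)) has_vector_derivative
      ?w \<theta> *\<^sub>R modes \<kappa> g'' A'' B'' (\<phi>, \<theta>) + ?w' *\<^sub>R modes \<kappa> g' A' B' (\<phi>, \<theta>)) (at \<theta>)"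
    by (rule has_vector_derivative_transform_within_open[OF _ _ \<theta>]) (auto simp: dtheta_modes[OF C2])
  then have "dtheta (\<lambda>q. ?w (snd q) *\<^sub>R dtheta (modes \<kappa> g A B) q) p =
      ?w \<theta> *\<^sub>R modes \<kappa> g'' A'' B'' (\<phi>, \<theta>) + ?w' *\<^sub>R modes \<kappa> g' A' B' (\<phi>, \<theta>)"
    by (subst dtheta_def) (simp add: p_eq vector_derivative_at)
  then have "LB b (modes \<kappa> g A B) p =
     (1 / (cos \<theta>)\<^sup>2) *\<^sub>R modes \<kappa> (\<lambda>_. 0) (\<lambda>\<theta>. \<kappa> * (\<kappa> * A \<theta>)) (\<lambda>\<theta>. - \<kappa> * (- \<kappa> * B \<theta>)) (\<phi>, \<theta>) +
     (1 / (cos \<theta> * rho b \<theta>)) *\<^sub>R (?w \<theta> *\<^sub>R modes \<kappa> g'' A'' B'' (\<phi>, \<theta>) + ?w' *\<^sub>R modes \<kappa> g' A' B' (\<phi>, \<theta>))"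
    unfolding LB_def by (simp add: dphi_modes p_eq)
  also have "(1 / (cos \<theta> * rho b \<theta>)) *\<^sub>R (?w \<theta> *\<^sub>R modes \<kappa> g'' A'' B'' (\<phi>, \<theta>) + ?w' *\<^sub>R modes \<kappa> g' A' B' (\<phi>, \<theta>))
     = (inverse (rho b \<theta>))\<^sup>2 *\<^sub>R modes \<kappa> g'' A'' B'' (\<phi>, \<theta>) + drift b \<theta> *\<^sub>R modes \<kappa> g' A' B' (\<phi>, \<theta>)"
  proof -
    have "1 / (cos \<theta> * rho b \<theta>) * ?w \<theta> = (inverse (rho b \<theta>))\<^sup>2"
      "1 / (cos \<theta> * rho b \<theta>) * ?w' = drift b \<theta>"
      using nz by (simp_all add: power2_eq_square field_simps)
    then show ?thesis by (simp only: scaleR_add_right scaleR_scaleR)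
  qed
  finally show ?thesis
    by (rule trans) (simp add: p_eq modes_def zonal_LB_def scaleR_conv_of_real algebra_simps power2_eq_square)
qed

section \<open>Phases in longitude, and uniqueness for linear second order equations\<close>

lemma exp_half_turn:
  assumes "m \<noteq> 0"
  shows "exp (\<i> * of_int m * of_real (pi / (2 * of_int m))) = \<i>"
    "exp (- (\<i> * of_int m) * of_real (pi / (2 * of_int m))) = - \<i>"
proof -
  have "\<i> * of_int m * of_real (pi / (2 * of_int m)) = \<i> * of_real (pi / 2)"
    using assms by simp
  then show 1: "exp (\<i> * of_int m * of_real (pi / (2 * of_int m))) = \<i>"
    by (simp only: cis_conv_exp[symmetric] cis_pi_half)
  have "exp (- (\<i> * of_int m) * of_real (pi / (2 * of_int m))) = inverse (exp (\<i> * of_int m * of_real (pi / (2 * of_int m))))"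
    by (simp only: exp_minus[symmetric] minus_mult_left)
  then show "exp (- (\<i> * of_int m) * of_real (pi / (2 * of_int m))) = - \<i>" unfolding 1 by simp
qed

text \<open>Three longitudes suffice: at 0, pi / (2 m) and pi / m the first exponential is 1, \<i>,
  -1 and the second 1, -\<i>, -1. The first and last samples give C = - C; the first two then force
  both coefficients to vanish.\<close>

lemma modes_zonal_imp_zero:
  assumes "m \<noteq> 0" "\<And>\<phi>. C = modes (\<i> * of_int m) (\<lambda>_. 0) A B (\<phi>, \<theta>)"
  shows "C = 0" "A \<theta> = 0 \<and> B \<theta> = 0"
proof -
  define h :: real where "h = pi / (2 * of_int m)"
  note half = exp_half_turn[OF assms(1), folded h_def]
  have e: "C = A \<theta> + B \<theta>" using assms(2)[of 0] by (simp add: modes_def)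
  have i: "C = A \<theta> * \<i> + B \<theta> * (- \<i>)"
    using assms(2)[of h] by (simp only: modes_def fst_conv snd_conv half) simp
  have "exp (\<i> * of_int m * of_real (h + h)) = -1" "exp (- (\<i> * of_int m) * of_real (h + h)) = -1"
    by (simp_all only: of_real_add distrib_left exp_add half) simp_all
  then have "C = - A \<theta> - B \<theta>"
    using assms(2)[of "h + h"] by (simp only: modes_def fst_conv snd_conv) simp
  with e have "C = - C" by simp
  then show "C = 0" by (simp add: complex_eq_iff)
  with e i have "B \<theta> = - A \<theta>" "A \<theta> * \<i> = B \<theta> * \<i>" by (simp_all add: eq_neg_iff_add_eq_0 add.commute)
  then show "A \<theta> = 0 \<and> B \<theta> = 0" by (simp add: complex_eq_iff)
qed

lemma C2_data_of_Cinf: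
  fixes y :: "real \<Rightarrow> complex"
  assumes "Cinf_on latitudes y"
  obtains y' y'' where "C2_data y y' y''"
proof -
  let ?y' = "\<lambda>x. frechet_derivative y (at x) 1"
  have "Ck_on (Suc (Suc 0)) latitudes y" using assms unfolding Cinf_on_def by blast
  then have "y differentiable at x" "?y' differentiable at x" if "x \<in> latitudes" for x
    using that by (auto simp: differentiable_on_eq_differentiable_at)
  moreover have "(f has_vector_derivative frechet_derivative f (at x) 1) (at x)"
    if "f differentiable at x" for f :: "real \<Rightarrow> complex" and x
  proof -
    have "linear (frechet_derivative f (at x))" using that by (rule linear_frechet_derivative)
    then have "frechet_derivative f (at x) = (\<lambda>h. h *\<^sub>R frechet_derivative f (at x) 1)"
      by (metis linear_scale mult.right_neutral real_scaleR_def)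
    then show ?thesis using that frechet_derivative_works unfolding has_vector_derivative_def by metis
  qed
  ultimately have "C2_data y ?y' (\<lambda>x. frechet_derivative ?y' (at x) 1)"
    unfolding C2_data_def by blast
  then show ?thesis using that by blast
qed

text \<open>Gronwall argument for the energy E = f^2 + f1^2. The coefficients may blow up at the
  ends of the interval, so the estimate is made on the compact segment \<open>J\<close> between
  \<open>x0\<close> and \<open>x\<close>. There |E'| <= C E, so exp(-C t) E does not increase to the
  right of \<open>x0\<close>, and exp(C t) E does not decrease towards \<open>x0\<close> from the
  left.\<close>

lemma second_order_ode_unique:
  fixes f f1 f2 p q :: "real \<Rightarrow> real"
  assumes d: "\<And>x. x \<in> {lo<..<hi} \<Longrightarrow> (f has_real_derivative f1 x) (at x)"
      "\<And>x. x \<in> {lo<..<hi} \<Longrightarrow> (f1 has_real_derivative f2 x) (at x)"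
    and ode: "\<And>x. x \<in> {lo<..<hi} \<Longrightarrow> f2 x = p x * f1 x + q x * f x"
    and cont: "continuous_on {lo<..<hi} p" "continuous_on {lo<..<hi} q"
    and x0: "x0 \<in> {lo<..<hi}" "f x0 = 0" "f1 x0 = 0" and x: "x \<in> {lo<..<hi}"
  shows "f x = 0"
proof -
  define J where "J = {min x x0..max x x0}"
  have J: "J \<subseteq> {lo<..<hi}" "compact J" using x x0 by (auto simp: J_def)
  have "bounded (p ` J)" "bounded (q ` J)"
    using J cont by (meson compact_continuous_image compact_imp_bounded continuous_on_subset)+
  then obtain M1 M2 where M12: "\<And>t. t \<in> J \<Longrightarrow> \<bar>p t\<bar> \<le> M1" "\<And>t. t \<in> J \<Longrightarrow> \<bar>q t\<bar> \<le> M2"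
    unfolding bounded_iff by (metis imageI real_norm_def)
  define M where "M = max M1 M2"
  have M: "\<bar>p t\<bar> \<le> M" "\<bar>q t\<bar> \<le> M" if "t \<in> J" for t using M12[OF that] by (auto simp: M_def)
  \<comment> \<open>From 2 |f f1| <= E the mixed term contributes 1 and the term with
    \<open>q\<close> contributes M; the term with \<open>p\<close> contributes 2 M.\<close>
  define C where "C = 1 + 3 * M"
  define E where "E = (\<lambda>t. (f t)\<^sup>2 + (f1 t)\<^sup>2)"
  define E' where "E' = (\<lambda>t. 2 * f t * f1 t + 2 * f1 t * (p t * f1 t + q t * f t))"
  have E': "(E has_real_derivative E' t) (at t)" if "t \<in> J" for t
    unfolding E_def E'_def
    using d[of t] ode[of t] that J by (auto intro!: derivative_eq_intros)
  have bound: "\<bar>E' t\<bar> \<le> C * E t" if "t \<in> J" for t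
  proof -
    have ff: "2 * \<bar>f t * f1 t\<bar> \<le> E t"
      using sum_squares_bound[of "\<bar>f t\<bar>" "\<bar>f1 t\<bar>"] by (simp add: E_def abs_mult)
    have f1: "(f1 t)\<^sup>2 \<le> E t" by (simp add: E_def)
    have "\<bar>E' t\<bar> \<le> 2 * \<bar>f t * f1 t\<bar> + 2 * (\<bar>p t\<bar> * (f1 t)\<^sup>2) + \<bar>q t\<bar> * (2 * \<bar>f t * f1 t\<bar>)"
    proof -
      have "E' t = 2 * (f t * f1 t) + 2 * (p t * (f1 t)\<^sup>2) + q t * (2 * (f t * f1 t))"
        by (simp add: E'_def power2_eq_square algebra_simps)
      also have "\<bar>\<dots>\<bar> \<le> \<bar>2 * (f t * f1 t)\<bar> + \<bar>2 * (p t * (f1 t)\<^sup>2)\<bar> + \<bar>q t * (2 * (f t * f1 t))\<bar>"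
        by linarith
      finally show ?thesis by (simp add: abs_mult)
    qed
    also have "\<dots> \<le> E t + 2 * (M * E t) + M * E t"
    proof (intro add_mono mult_left_mono mult_mono)
      show "0 \<le> M" using M[OF that] by linarith
    qed (use ff f1 M[OF that] in auto)
    finally show ?thesis by (simp add: C_def algebra_simps)
  qed
  have "E x \<le> 0"
  proof (cases "x0 \<le> x")
    case True
    have "exp (- C * x) * E x \<le> exp (- C * x0) * E x0"
    proof (rule DERIV_nonpos_imp_nonincreasing[OF True])
      fix t assume "x0 \<le> t" "t \<le> x"
      then have t: "t \<in> J" by (auto simp: J_def)
      have "((\<lambda>t. exp (- C * t) * E t) has_real_derivative exp (- C * t) * (E' t - C * E t)) (at t)"
        by (auto intro!: derivative_eq_intros E' t simp: algebra_simps)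
      moreover have "exp (- C * t) * (E' t - C * E t) \<le> 0"
        using bound[OF t] by (intro mult_nonneg_nonpos) auto
      ultimately show "\<exists>y. ((\<lambda>t. exp (- C * t) * E t) has_real_derivative y) (at t) \<and> y \<le> 0" by blast
    qed
    then show ?thesis using x0 by (simp add: E_def mult_le_0_iff)
  next
    case False
    then have "x \<le> x0" by simp
    have "exp (C * x) * E x \<le> exp (C * x0) * E x0"
    proof (rule DERIV_nonneg_imp_nondecreasing[OF \<open>x \<le> x0\<close>])
      fix t assume "x \<le> t" "t \<le> x0"
      then have t: "t \<in> J" by (auto simp: J_def)
      have "((\<lambda>t. exp (C * t) * E t) has_real_derivative exp (C * t) * (E' t + C * E t)) (at t)"
        by (auto intro!: derivative_eq_intros E' t simp: algebra_simps)
      moreover have "exp (C * t) * (E' t + C * E t) \<ge> 0"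
        using bound[OF t] by (intro mult_nonneg_nonneg) auto
      ultimately show "\<exists>y. ((\<lambda>t. exp (C * t) * E t) has_real_derivative y) (at t) \<and> y \<ge> 0" by blast
    qed
    then show ?thesis using x0 by (simp add: E_def mult_le_0_iff)
  qed
  then show "f x = 0" by (simp add: E_def sum_power2_le_zero_iff)
qed

subsection \<open>Zonal eigenfunctions at the poles\<close>

text \<open>With \<open>s = sin \<theta>\<close>, \<open>R = \<rho>\<^sup>2\<close>, a zonal eigenfunction \<open>K(s)\<close> satisfies
  \<open>(1 - s\<^sup>2) R K'' - u K' + \<lambda> R\<^sup>2 K = 0\<close>; the coefficients are polynomials in \<open>s\<close>.\<close>

definition profile_R :: "real \<Rightarrow> real \<Rightarrow> real" where
  "profile_R b s = b\<^sup>2 + (1 - b\<^sup>2) * s\<^sup>2"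

definition profile_u :: "real \<Rightarrow> real \<Rightarrow> real" where
  "profile_u b s = 2 * s * profile_R b s + (1 - s\<^sup>2) * (1 - b\<^sup>2) * s"

lemma rho_profile_R: "(rho b \<theta>)\<^sup>2 = profile_R b (sin \<theta>)"
  by (simp add: rho_square profile_R_def cos_squared_eq algebra_simps)

lemma profile_R_pos:
  assumes "0 < b" "b < 1"
  shows "0 < profile_R b s"
proof -
  have "b\<^sup>2 < 1" using assms by (simp add: abs_square_less_1)
  then have "0 \<le> (1 - b\<^sup>2) * s\<^sup>2" by simp
  moreover have "0 < b\<^sup>2" using assms by simp
  ultimately show ?thesis unfolding profile_R_def by linarith
qed

lemma profile_u_minus: "profile_u b (- s) = - profile_u b s"
  by (simp add: profile_u_def profile_R_def)

text \<open>The substitution s = 1 - t gives 1 - s^2 = t (2 - t) and reverses the sign of the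
  first-order term. Since \<rho>^2 = 1 at a pole, (2 - t) R and the coefficient
  \<open>profile_u\<close> both equal 2 at t = 0, which is the case treated by
  \<open>frobenius_solution\<close>.\<close>

lemma pole_series:
  fixes b lam :: real
  obtains P :: "real fps" and r :: real where "0 < r" "r \<le> 1" "ereal r \<le> fps_conv_radius P"
    "\<And>t. \<bar>t\<bar> < r \<Longrightarrow> eval_fps P t \<noteq> 0"
    "\<And>t. \<bar>t\<bar> < r \<Longrightarrow> (2 * t - t\<^sup>2) * profile_R b (1 - t) * eval_fps (fps_deriv (fps_deriv P)) t
        + profile_u b (1 - t) * eval_fps (fps_deriv P) t + lam * (profile_R b (1 - t))\<^sup>2 * eval_fps P t = 0"
proof -
  define \<beta> where "\<beta> = 1 - b\<^sup>2"
  define Rp where "Rp = [:1, - 2 * \<beta>, \<beta>:]"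
  have Rp: "poly Rp t = profile_R b (1 - t)" for t
    by (simp add: Rp_def profile_R_def \<beta>_def power2_eq_square algebra_simps)
  define c where "c = [:2, -2:] * Rp + [:0, 2 * \<beta>, - \<beta>:] * [:1, -1:]"
  have c: "poly c t = profile_u b (1 - t)" for t
    by (simp add: c_def Rp profile_u_def \<beta>_def power2_eq_square algebra_simps)
  have coeffs: "coeff ([:2, -1:] * Rp) 0 = 2" "coeff c 0 = 2"
    by (simp_all add: Rp_def c_def coeff_mult_0)
  obtain P :: "real fps" and r where P: "0 < r" "ereal r \<le> fps_conv_radius P" "P $ 0 = 1"
    and ode: "\<And>t. \<bar>t\<bar> < r \<Longrightarrow> t * poly ([:2, -1:] * Rp) t * eval_fps (fps_deriv (fps_deriv P)) t
        + poly c t * eval_fps (fps_deriv P) t + poly (smult lam (Rp * Rp)) t * eval_fps P t = 0"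
    by (rule frobenius_solution[OF coeffs, of "smult lam (Rp * Rp)"]) (rule that)
  have "ereal (norm (0::real)) < fps_conv_radius P"
    using P(1,2) less_le_trans[of 0 "ereal r" "fps_conv_radius P"] by (simp add: zero_ereal_def[symmetric])
  from DERIV_isCont[OF has_field_derivative_eval_fps[OF this]]
  have "isCont (eval_fps P) 0" .
  moreover have "eval_fps P 0 \<noteq> 0" using P by (simp add: eval_fps_at_0)
  ultimately obtain e where e: "0 < e" "\<And>t. dist t 0 < e \<Longrightarrow> eval_fps P t \<noteq> 0"
    using continuous_at_avoid[of 0 "eval_fps P" 0] by (auto simp: dist_commute)
  \<comment> \<open>The bound 1 keeps 1 - t away from the opposite pole, and \<open>e\<close> keeps
    t away from the zeros of the series, whose value at 0 is 1.\<close>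
  define r' where "r' = min 1 (min e r)"
  show ?thesis
  proof (rule that[of r' P])
    show "ereal r' \<le> fps_conv_radius P"
    proof -
      have "r' \<le> r" by (simp add: r'_def)
      then show ?thesis using P(2) order_trans ereal_less_eq(3) by blast
    qed
    fix t assume t: "\<bar>t\<bar> < r'"
    then show "eval_fps P t \<noteq> 0" using e(2)[of t] by (simp add: r'_def)
    have eqs: "t * poly ([:2, -1:] * Rp) t = (2 * t - t\<^sup>2) * profile_R b (1 - t)"
      "poly (smult lam (Rp * Rp)) t = lam * (profile_R b (1 - t))\<^sup>2"
      by (simp_all add: Rp algebra_simps power2_eq_square)
    have "\<bar>t\<bar> < r" using t by (simp add: r'_def)
    from ode[OF this]
    show "(2 * t - t\<^sup>2) * profile_R b (1 - t) * eval_fps (fps_deriv (fps_deriv P)) t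
        + profile_u b (1 - t) * eval_fps (fps_deriv P) t + lam * (profile_R b (1 - t))\<^sup>2 * eval_fps P t = 0"
      unfolding eqs c .
  qed (use P e in \<open>auto simp: r'_def\<close>)
qed

text \<open>Both poles are handled at once through \<sigma>: under s -> -s, \<open>profile_R\<close>
  is even and \<open>profile_u\<close> is odd, so the reflected profile satisfies the same equation
  in t.\<close>

lemma pole_proportional:
  fixes P :: "real fps" and K K1 K2 :: "real \<Rightarrow> real"
  assumes b: "0 < b" "b < 1"
    and P: "0 < r" "r \<le> 1" "ereal r \<le> fps_conv_radius P" "\<And>t. \<bar>t\<bar> < r \<Longrightarrow> eval_fps P t \<noteq> 0"
    "\<And>t. \<bar>t\<bar> < r \<Longrightarrow> (2 * t - t\<^sup>2) * profile_R b (1 - t) * eval_fps (fps_deriv (fps_deriv P)) t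
        + profile_u b (1 - t) * eval_fps (fps_deriv P) t + lam * (profile_R b (1 - t))\<^sup>2 * eval_fps P t = 0"
    and K: "\<And>s. s \<in> {-1<..<1} \<Longrightarrow> (K has_real_derivative K1 s) (at s)"
      "\<And>s. s \<in> {-1<..<1} \<Longrightarrow> (K1 has_real_derivative K2 s) (at s)"
    and ode: "\<And>s. s \<in> {-1<..<1} \<Longrightarrow>
        (1 - s\<^sup>2) * profile_R b s * K2 s = profile_u b s * K1 s - lam * (profile_R b s)\<^sup>2 * K s"
    and \<sigma>: "\<sigma> = 1 \<or> \<sigma> = -1"
    and lim: "((\<lambda>t. t * K (\<sigma> * (1 - t))) \<longlongrightarrow> 0) (at_right 0)"
      "((\<lambda>t. t * K1 (\<sigma> * (1 - t))) \<longlongrightarrow> 0) (at_right 0)"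
  obtains k where "\<And>t. t \<in> {0<..<r} \<Longrightarrow> K (\<sigma> * (1 - t)) = k * eval_fps P t"
proof -
  define R where "R = (\<lambda>t. profile_R b (1 - t))"
  have R: "0 < R t" for t using profile_R_pos b by (simp add: R_def)
  have inS: "\<sigma> * (1 - t) \<in> {-1<..<1}" if "t \<in> {0<..<r}" for t
    using that \<sigma> P(2) by auto
  have lt: "ereal (norm t) < fps_conv_radius Q" if "\<bar>t\<bar> < r" "ereal r \<le> fps_conv_radius Q"
    for t and Q :: "real fps"
    using that by (metis less_ereal.simps(1) order_less_le_trans real_norm_def)
  have rad1: "ereal r \<le> fps_conv_radius (fps_deriv P)" using P(3) fps_conv_radius_deriv order_trans by blast
  \<comment> \<open>Integrating factor: the quotient of the first and second order coefficients is 2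
    (1 - t) / (2 t - t^2) + (1 - b^2) (1 - t) / R, which is the derivative of log (2 t - t^2) - (log
    R) / 2.\<close>
  define M where "M = (\<lambda>t. (2 * t - t\<^sup>2) / sqrt (R t))"
  define M' where "M' = (\<lambda>t. (2 - 2 * t) / sqrt (R t) + (2 * t - t\<^sup>2) * (1 - b\<^sup>2) * (1 - t) / (R t * sqrt (R t)))"
  have l: "((\<lambda>t. \<sigma> * (1 - t)) has_real_derivative - \<sigma>) (at t)" for t
    by (auto intro!: derivative_eq_intros)
  have R_der: "(R has_real_derivative - 2 * (1 - b\<^sup>2) * (1 - t)) (at t)" for t
    unfolding R_def profile_R_def by (rule derivative_eq_intros refl)+ (simp add: algebra_simps)
  \<comment> \<open>This is \<open>M t\<close> divided by t. Its finite limit turns the hypotheses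
    on t K and t K1 into the limits required by the Wronskian argument.\<close>
  have factor: "((\<lambda>t. (2 - t) / sqrt (R t)) \<longlongrightarrow> (2 - 0) / sqrt (R 0)) (at_right 0)"
  proof (intro tendsto_intros)
    show "(R \<longlongrightarrow> R 0) (at_right 0)"
      using DERIV_isCont[OF R_der[of 0]] by (simp add: isCont_def filterlim_at_split)
    show "sqrt (R 0) \<noteq> 0" using R[of 0] by simp
  qed
  have cont: "(eval_fps Q \<longlongrightarrow> eval_fps Q 0) (at_right 0)" if "ereal r \<le> fps_conv_radius Q" for Q :: "real fps"
  proof -
    have "ereal (norm (0::real)) < fps_conv_radius Q" using lt[of 0 Q] P(1) that by simp
    from DERIV_isCont[OF has_field_derivative_eval_fps[OF this]] show ?thesis
      by (simp add: isCont_def filterlim_at_split)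
  qed
  show ?thesis
  proof (rule wronskian_proportional[of r "\<lambda>t. K (\<sigma> * (1 - t))" "\<lambda>t. - \<sigma> * K1 (\<sigma> * (1 - t))"
        "\<lambda>t. K2 (\<sigma> * (1 - t))" "eval_fps P" "eval_fps (fps_deriv P)" "eval_fps (fps_deriv (fps_deriv P))"
        "\<lambda>t. (2 * t - t\<^sup>2) * R t" "\<lambda>t. profile_u b (1 - t)" "\<lambda>t. lam * (R t)\<^sup>2" M M'])
    show "0 < r" by fact
    fix t assume t: "t \<in> {0<..<r}"
    have pos: "0 < 2 * t - t\<^sup>2" using t P(2) by (simp add: power2_eq_square)
    show "((\<lambda>t. K (\<sigma> * (1 - t))) has_real_derivative - \<sigma> * K1 (\<sigma> * (1 - t))) (at t)"
      using DERIV_chain2[OF K(1)[OF inS[OF t]] l] by (simp add: mult.commute)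
    show "((\<lambda>t. - \<sigma> * K1 (\<sigma> * (1 - t))) has_real_derivative K2 (\<sigma> * (1 - t))) (at t)"
      using DERIV_cmult[OF DERIV_chain2[OF K(2)[OF inS[OF t]] l], of "- \<sigma>"] \<sigma> by auto
    show "(eval_fps P has_real_derivative eval_fps (fps_deriv P) t) (at t)"
      "(eval_fps (fps_deriv P) has_real_derivative eval_fps (fps_deriv (fps_deriv P)) t) (at t)"
      using t P(3) rad1 by (auto intro!: has_field_derivative_eval_fps lt)
    have s2: "(\<sigma> * (1 - t))\<^sup>2 = (1 - t)\<^sup>2" using \<sigma> by (auto simp: power_mult_distrib)
    have "profile_R b (\<sigma> * (1 - t)) = R t" by (simp only: profile_R_def R_def s2)
    moreover have "profile_u b (\<sigma> * (1 - t)) = \<sigma> * profile_u b (1 - t)"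
      using \<sigma> profile_u_minus[of b "1 - t"] by auto
    moreover have "1 - (\<sigma> * (1 - t))\<^sup>2 = 2 * t - t\<^sup>2" unfolding s2 by (simp add: power2_eq_square algebra_simps)
    ultimately have "(2 * t - t\<^sup>2) * R t * K2 (\<sigma> * (1 - t)) =
        \<sigma> * profile_u b (1 - t) * K1 (\<sigma> * (1 - t)) - lam * (R t)\<^sup>2 * K (\<sigma> * (1 - t))"
      using ode[OF inS[OF t]] by simp
    then show "(2 * t - t\<^sup>2) * R t * K2 (\<sigma> * (1 - t)) + profile_u b (1 - t) * (- \<sigma> * K1 (\<sigma> * (1 - t)))
        + lam * (R t)\<^sup>2 * K (\<sigma> * (1 - t)) = 0"
      by simp
    show "(2 * t - t\<^sup>2) * R t * eval_fps (fps_deriv (fps_deriv P)) t + profile_u b (1 - t) * eval_fps (fps_deriv P) t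
        + lam * (R t)\<^sup>2 * eval_fps P t = 0"
      using P(5)[of t] t by (simp add: R_def)
    show "(2 * t - t\<^sup>2) * R t \<noteq> 0" "M t \<noteq> 0" "eval_fps P t \<noteq> 0"
      using pos R[of t] P(4)[of t] t by (auto simp: M_def)
    have sq: "sqrt (R t) * sqrt (R t) = R t" "sqrt (R t) \<noteq> 0" using R[of t] by simp_all
    have d1: "((\<lambda>t. sqrt (R t)) has_real_derivative inverse (sqrt (R t)) / 2 * (- 2 * (1 - b\<^sup>2) * (1 - t))) (at t)"
      by (rule DERIV_chain2[where f = sqrt and g = R, OF DERIV_real_sqrt[OF R] R_der])
    have d2: "((\<lambda>t. 2 * t - t\<^sup>2) has_real_derivative 2 - 2 * t) (at t)"
      by (auto intro!: derivative_eq_intros)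
    have "(M has_real_derivative
        ((2 - 2 * t) * sqrt (R t) - (2 * t - t\<^sup>2) * (inverse (sqrt (R t)) / 2 * (- 2 * (1 - b\<^sup>2) * (1 - t))))
          / (sqrt (R t) * sqrt (R t))) (at t)"
      unfolding M_def by (rule DERIV_divide[OF d2 d1 sq(2)])
    moreover have "((2 - 2 * t) * q - A * (inverse q / 2 * (- 2 * \<beta> * s))) / (q * q)
        = (2 - 2 * t) / q + A * \<beta> * s / (q * q * q)" if "q \<noteq> 0" for q A \<beta> s :: real
      using that by (simp add: field_simps)
    ultimately show "(M has_real_derivative M' t) (at t)"
      using sq unfolding M'_def by metis
    have pu: "profile_u b (1 - t) = 2 * (1 - t) * R t + (2 * t - t\<^sup>2) * (1 - b\<^sup>2) * (1 - t)"
      unfolding profile_u_def R_def by (simp add: power2_eq_square algebra_simps)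
    have "A * (q * q) * ((2 - 2 * t) / q + A * \<beta> * (1 - t) / (q * q * q)) =
        (2 * (1 - t) * (q * q) + A * \<beta> * (1 - t)) * (A / q)" if "q \<noteq> 0" for q A \<beta> :: real
      using that by (simp add: field_simps)
    note eq = this[OF sq(2), of "2 * t - t\<^sup>2" "1 - b\<^sup>2"]
    show "(2 * t - t\<^sup>2) * R t * M' t = profile_u b (1 - t) * M t"
      unfolding pu M'_def M_def using eq[unfolded sq(1)] .
  next
    have "((\<lambda>t. (2 - t) / sqrt (R t) * (t * K (\<sigma> * (1 - t)))) \<longlongrightarrow> (2 - 0) / sqrt (R 0) * 0) (at_right 0)"
      by (rule tendsto_mult[OF factor lim(1)])
    then show "((\<lambda>t. M t * K (\<sigma> * (1 - t))) \<longlongrightarrow> 0) (at_right 0)"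
      by (simp add: M_def power2_eq_square algebra_simps)
    have "((\<lambda>t. - \<sigma> * ((2 - t) / sqrt (R t) * (t * K1 (\<sigma> * (1 - t))))) \<longlongrightarrow> - \<sigma> * ((2 - 0) / sqrt (R 0) * 0)) (at_right 0)"
      by (rule tendsto_mult_left[OF tendsto_mult[OF factor lim(2)]])
    then show "((\<lambda>t. M t * (- \<sigma> * K1 (\<sigma> * (1 - t)))) \<longlongrightarrow> 0) (at_right 0)"
      by (simp add: M_def power2_eq_square algebra_simps)
    show "(eval_fps P \<longlongrightarrow> eval_fps P 0) (at_right 0)"
      "(eval_fps (fps_deriv P) \<longlongrightarrow> eval_fps (fps_deriv P) 0) (at_right 0)"
      using cont P(3) rad1 by blast+
  qed (rule that)
qed

text \<open>Three open sets cover [-1, 1]: on the open interval the equation itself yields all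
  derivatives, and around each pole the extension is a multiple of the series.\<close>

lemma profile_extends_past_poles:
  fixes K K1 K2 :: "real \<Rightarrow> real" and h :: "'a::real_normed_vector \<Rightarrow> real"
  assumes b: "0 < b" "b < 1"
    and h: "bounded_linear h"
    and K: "\<And>s. s \<in> {-1<..<1} \<Longrightarrow> (K has_real_derivative K1 s) (at s)"
      "\<And>s. s \<in> {-1<..<1} \<Longrightarrow> (K1 has_real_derivative K2 s) (at s)"
    and ode: "\<And>s. s \<in> {-1<..<1} \<Longrightarrow>
        (1 - s\<^sup>2) * profile_R b s * K2 s = profile_u b s * K1 s - lam * (profile_R b s)\<^sup>2 * K s"
    and lim: "\<And>\<sigma>. \<sigma> = 1 \<or> \<sigma> = -1 \<Longrightarrow> ((\<lambda>t. t * K (\<sigma> * (1 - t))) \<longlongrightarrow> 0) (at_right 0)"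
      "\<And>\<sigma>. \<sigma> = 1 \<or> \<sigma> = -1 \<Longrightarrow> ((\<lambda>t. t * K1 (\<sigma> * (1 - t))) \<longlongrightarrow> 0) (at_right 0)"
  obtains L S where "open S" "{-1..1} \<subseteq> S" "\<And>s. s \<in> {-1<..<1} \<Longrightarrow> L s = K s"
    "\<And>n. Ck_on n (h -` S) (\<lambda>q. complex_of_real (L (h q)))"
proof -
  obtain P :: "real fps" and r where P: "0 < r" "r \<le> 1" "ereal r \<le> fps_conv_radius P"
      "\<And>t. \<bar>t\<bar> < r \<Longrightarrow> eval_fps P t \<noteq> 0"
    "\<And>t. \<bar>t\<bar> < r \<Longrightarrow> (2 * t - t\<^sup>2) * profile_R b (1 - t) * eval_fps (fps_deriv (fps_deriv P)) t
        + profile_u b (1 - t) * eval_fps (fps_deriv P) t + lam * (profile_R b (1 - t))\<^sup>2 * eval_fps P t = 0"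
    by (rule pole_series[of b lam]) (rule that)
  obtain k where k: "\<And>t. t \<in> {0<..<r} \<Longrightarrow> K (1 * (1 - t)) = k * eval_fps P t"
    by (rule pole_proportional[OF b P K ode disjI1[OF refl] lim[OF disjI1[OF refl]]], assumption+) (rule that)
  obtain k' where k': "\<And>t. t \<in> {0<..<r} \<Longrightarrow> K (-1 * (1 - t)) = k' * eval_fps P t"
    by (rule pole_proportional[OF b P K ode disjI2[OF refl] lim[OF disjI2[OF refl]]], assumption+) (rule that)
  \<comment> \<open>The series supplies values only at and beyond the poles; on the overlaps inside
    the interval it agrees with \<open>K\<close> by \<open>k\<close> and \<open>k'\<close>, so all
    three local formulas describe one function.\<close>
  define L where "L = (\<lambda>s. if 1 \<le> s then k * eval_fps P (1 - 1 * s)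
      else if s \<le> -1 then k' * eval_fps P (1 - (-1) * s) else K s)"
  have mid: "L s = K s" if "s \<in> {-1<..<1}" for s using that by (simp add: L_def)
  let ?U = "\<lambda>\<sigma>. {s. \<bar>1 - \<sigma> * s\<bar> < r}"
  have north: "L s = k * eval_fps P (1 - 1 * s)" if "s \<in> ?U 1" for s
    using k[of "1 - s"] that P(2) by (auto simp: L_def)
  have south: "L s = k' * eval_fps P (1 - (-1) * s)" if "s \<in> ?U (-1)" for s
    using k'[of "1 + s"] that P(2) by (auto simp: L_def)
  have op: "open (h -` T)" if "open T" for T
    using that h by (intro continuous_open_vimage) (auto intro: linear_continuous_at)
  have oU: "open (?U \<sigma>)" for \<sigma> by (intro open_Collect_less continuous_intros)
  let ?w = "[:1, 0, -1:] * [:b\<^sup>2, 0, 1 - b\<^sup>2:]"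
    and ?u = "[:0, 2:] * [:b\<^sup>2, 0, 1 - b\<^sup>2:] + [:1, 0, -1:] * [:0, 1 - b\<^sup>2:]"
    and ?v = "smult (- lam) ([:b\<^sup>2, 0, 1 - b\<^sup>2:] * [:b\<^sup>2, 0, 1 - b\<^sup>2:])"
  have pR: "poly [:b\<^sup>2, 0, 1 - b\<^sup>2:] s = profile_R b s" and p1: "poly [:1, 0, -1:] s = 1 - s\<^sup>2" for s
    by (simp_all add: profile_R_def power2_eq_square algebra_simps)
  have Cmid: "Ck_on n (h -` {-1<..<1}) (\<lambda>q. complex_of_real (K (h q)))" for n
  proof (rule Ck_on_poly_ode[of _ h K K1 K2 ?w ?u ?v])
    fix s :: real assume s: "s \<in> {-1<..<1}"
    show "poly ?w s * K2 s = poly ?u s * K1 s + poly ?v s * K s"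
      unfolding poly_add poly_mult poly_smult pR p1 using ode[OF s]
      by (simp add: profile_u_def power2_eq_square algebra_simps)
    have "\<bar>s\<bar> < 1" using s by auto
    then have "s\<^sup>2 < 1" by (simp add: abs_square_less_1)
    then show "poly ?w s \<noteq> 0"
      unfolding poly_mult pR p1 using profile_R_pos[OF b, of s] by simp
  qed (use h K in auto)
  let ?S = "{-1<..<1} \<union> ?U 1 \<union> ?U (-1)"
  show ?thesis
  proof (rule that[of ?S L])
    show "open ?S" by (intro open_Un oU open_greaterThanLessThan)
    show "{-1..1} \<subseteq> ?S" using P(1) by (auto simp: less_le)
    show "L s = K s" if "s \<in> {-1<..<1}" for s using mid that .
    fix n
    let ?L = "\<lambda>q. complex_of_real (L (h q))"
    have "Ck_on n (h -` {-1<..<1}) ?L"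
      by (rule Ck_on_cong[OF op _ Cmid]) (use mid in auto)
    moreover have "Ck_on n (h -` ?U 1) ?L"
      by (rule Ck_on_cong[OF op[OF oU] _ Ck_on_eval_fps[OF h P(3), of n 1 k]]) (use north in auto)
    moreover have "Ck_on n (h -` ?U (-1)) ?L"
      by (rule Ck_on_cong[OF op[OF oU] _ Ck_on_eval_fps[OF h P(3), of n "-1" k']]) (use south in auto)
    ultimately show "Ck_on n (h -` ?S) ?L"
      unfolding vimage_Un by (intro Ck_on_Un open_Un op oU open_greaterThanLessThan)
  qed
qed

text \<open>A bounded derivative keeps \<open>H\<close> bounded near the pole, whence t H tends to
  0. For the second limit, 1 - (1 - t)^2 = 2 t - t^2 >= t^2 on (0, 1), so t divided by the root is
  at most 1 and the expression is dominated by |H1|.\<close>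

lemma limit_at_north_pole:
  fixes H H1 :: "real \<Rightarrow> real"
  assumes H: "\<And>\<theta>. \<theta> \<in> latitudes \<Longrightarrow> (H has_real_derivative H1 \<theta>) (at \<theta>)"
    and lim: "(H1 \<longlongrightarrow> 0) (at_left (pi / 2))"
  shows "((\<lambda>t. t * H (arcsin (1 - t))) \<longlongrightarrow> 0) (at_right 0)"
    "((\<lambda>t. t * (H1 (arcsin (1 - t)) / sqrt (1 - (1 - t)\<^sup>2))) \<longlongrightarrow> 0) (at_right 0)"
proof -
  have ev01: "\<forall>\<^sub>F t in at_right 0. t \<in> {0<..<1::real}" by (rule eventually_at_right_real) simp
  have arc: "filterlim (\<lambda>t. arcsin (1 - t)) (at_left (pi / 2)) (at_right 0)"
    unfolding filterlim_at
  proof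
    show "\<forall>\<^sub>F t in at_right 0. arcsin (1 - t) \<in> {..<pi / 2} \<and> arcsin (1 - t) \<noteq> pi / 2"
      using ev01
    proof eventually_elim
      case (elim t)
      have "arcsin (1 - t) < pi / 2" using arcsin_lt_bounded[of "1 - t"] elim by simp
      then show ?case by simp
    qed
    have "((\<lambda>t. arcsin (1 - t)) \<longlongrightarrow> arcsin (1 - 0)) (at_right 0)"
    proof (rule continuous_on_tendsto_compose[OF continuous_on_arcsin'])
      show "((\<lambda>t. 1 - t) \<longlongrightarrow> 1 - 0) (at_right (0::real))" by (intro tendsto_intros)
      show "\<forall>\<^sub>F t in at_right 0. 1 - t \<in> {-1..1::real}" using ev01 by eventually_elim auto
    qed auto
    then show "((\<lambda>t. arcsin (1 - t)) \<longlongrightarrow> pi / 2) (at_right 0)" by simp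
  qed
  have "\<forall>\<^sub>F x in at_left (pi / 2). \<bar>H1 x\<bar> < 1"
    using order_tendstoD(2)[OF tendsto_rabs[OF lim], of 1] by simp
  then obtain x0 where x0: "x0 < pi / 2" "\<And>x. x0 < x \<Longrightarrow> x < pi / 2 \<Longrightarrow> \<bar>H1 x\<bar> < 1"
    unfolding eventually_at_left_field by blast
  \<comment> \<open>Prepares a base point \<open>y\<close> inside the strip and beyond
    \<open>x0\<close>, where |H1| < 1; by the mean value theorem \<open>H\<close> then changes by at
    most pi between \<open>y\<close> and the pole.\<close>
  define y0 where "y0 = max x0 0"
  have "0 \<le> y0" "x0 \<le> y0" "y0 < pi / 2" using x0(1) pi_gt_zero unfolding y0_def max_def by auto
  moreover define y where "y = (y0 + pi / 2) / 2"
  ultimately have y: "0 < y" "x0 < y" "y < pi / 2" using pi_gt_zero by auto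
  have bound: "\<bar>H x\<bar> \<le> \<bar>H y\<bar> + pi" if x: "y < x" "x < pi / 2" for x
  proof -
    obtain z where z: "y < z" "z < x" "H x - H y = (x - y) * H1 z"
      using MVT2[OF x(1), of H H1] H x y by auto
    have "\<bar>H x - H y\<bar> = (x - y) * \<bar>H1 z\<bar>" using z(3) x by (simp add: abs_mult)
    also have "\<dots> \<le> pi * 1"
      using x0(2)[of z] x y z by (intro mult_mono) auto
    finally show ?thesis by linarith
  qed
  have evy: "\<forall>\<^sub>F x in at_left (pi / 2). y < x \<and> x < pi / 2"
    using eventually_at_left_real[OF y(3)] by simp
  show "((\<lambda>t. t * H (arcsin (1 - t))) \<longlongrightarrow> 0) (at_right 0)"
  proof (rule Lim_null_comparison)
    have "\<forall>\<^sub>F x in at_left (pi / 2). \<bar>H x\<bar> \<le> \<bar>H y\<bar> + pi"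
      using evy by eventually_elim (use bound in auto)
    then have "\<forall>\<^sub>F t in at_right 0. \<bar>H (arcsin (1 - t))\<bar> \<le> \<bar>H y\<bar> + pi"
      using arc by (rule eventually_compose_filterlim)
    with ev01 show "\<forall>\<^sub>F t in at_right 0. norm (t * H (arcsin (1 - t))) \<le> t * (\<bar>H y\<bar> + pi)"
      by eventually_elim (simp add: abs_mult mult_left_mono)
    have "((\<lambda>t. t * (\<bar>H y\<bar> + pi)) \<longlongrightarrow> 0 * (\<bar>H y\<bar> + pi)) (at_right 0)" by (intro tendsto_intros)
    then show "((\<lambda>t. t * (\<bar>H y\<bar> + pi)) \<longlongrightarrow> 0) (at_right 0)" by simp
  qed
  show "((\<lambda>t. t * (H1 (arcsin (1 - t)) / sqrt (1 - (1 - t)\<^sup>2))) \<longlongrightarrow> 0) (at_right 0)"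
  proof (rule Lim_null_comparison)
    show "((\<lambda>t. \<bar>H1 (arcsin (1 - t))\<bar>) \<longlongrightarrow> 0) (at_right 0)"
      using tendsto_rabs_zero[OF filterlim_compose[OF lim arc]] .
    show "\<forall>\<^sub>F t in at_right 0. norm (t * (H1 (arcsin (1 - t)) / sqrt (1 - (1 - t)\<^sup>2))) \<le> \<bar>H1 (arcsin (1 - t))\<bar>"
      using ev01
    proof eventually_elim
      case (elim t)
      have "t * t \<le> t * 1" using elim by (intro mult_left_mono) auto
      then have "t\<^sup>2 \<le> 1 - (1 - t)\<^sup>2" by (simp add: power2_eq_square algebra_simps)
      then have le: "t \<le> sqrt (1 - (1 - t)\<^sup>2)" by (rule real_le_rsqrt)
      have "0 < t" using elim by simp
      then have pos: "0 < sqrt (1 - (1 - t)\<^sup>2)" using le by (rule less_le_trans)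
      with le have "t / sqrt (1 - (1 - t)\<^sup>2) \<le> 1" by (simp only: divide_le_eq_1_pos)
      then have "t / sqrt (1 - (1 - t)\<^sup>2) * \<bar>H1 (arcsin (1 - t))\<bar> \<le> 1 * \<bar>H1 (arcsin (1 - t))\<bar>"
        by (rule mult_right_mono) simp
      moreover have "norm (t * (H1 (arcsin (1 - t)) / sqrt (1 - (1 - t)\<^sup>2)))
          = t / sqrt (1 - (1 - t)\<^sup>2) * \<bar>H1 (arcsin (1 - t))\<bar>"
        using elim less_imp_le[OF pos] unfolding real_norm_def abs_mult abs_divide by (simp only: abs_of_nonneg) simp
      ultimately show ?case by simp
    qed
  qed
qed

text \<open>The third coordinate of a surface point is b sin \<theta>, so a profile in sin \<theta>
  extends to ambient space as a function of the single linear form z / b.\<close>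

lemma smooth_on_ellipsoid_profile:
  assumes "0 < b" "open S" "{-1..1} \<subseteq> S"
    and Ck: "\<And>n. Ck_on n ((\<lambda>q. snd (snd q) / b) -` S) (\<lambda>q :: real \<times> real \<times> real. complex_of_real (L (snd (snd q) / b)))"
  shows "smooth_on_ellipsoid b (\<lambda>p. complex_of_real (L (sin (snd p))))"
proof -
  let ?h = "\<lambda>q :: real \<times> real \<times> real. snd (snd q) / b"
  have "open (?h -` S)"
    using assms(1,2) by (intro continuous_open_vimage) (auto intro!: continuous_intros)
  moreover have "sin x \<in> S" for x :: real using assms(3) by (rule subsetD) simp
  then have "ellipsoid b \<subseteq> ?h -` S"
    using assms(1) by (auto simp: ellipsoid_def ell_param_def)
  moreover have "Cinf_on (?h -` S) (\<lambda>q. complex_of_real (L (?h q)))" using Ck by (simp add: Cinf_on_def)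
  moreover have "\<forall>p. complex_of_real (L (sin (snd p))) = complex_of_real (L (?h (ell_param b p)))"
    using assms(1) by (simp add: ell_param_def)
  ultimately show ?thesis unfolding smooth_on_ellipsoid_def by blast
qed

text \<open>\<open>F\<close> is compared with \<open>H\<close> only between the poles, which is
  enough because that strip is open; the case \<kappa> = 0 of \<open>LB_modes\<close>
  applies.\<close>

lemma LB_zonal:
  fixes H H1 H2 :: "real \<Rightarrow> real"
  assumes "0 < b" "C2_data H H1 H2" "\<And>q. snd q \<in> latitudes \<Longrightarrow> F q = complex_of_real (H (snd q))"
    "snd p \<in> latitudes"
    "F = (\<lambda>q. G (snd q))"
  shows "LB b F p = complex_of_real (zonal_LB b H1 H2 (snd p))"
proof -
  have G: "G \<theta> = of_real (H \<theta>)" if "\<theta> \<in> latitudes" for \<theta>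
    using assms(3)[of "(0, \<theta>)"] that by (simp add: assms(5))
  have "C2_data G (\<lambda>\<theta>. of_real (H1 \<theta>)) (\<lambda>\<theta>. of_real (H2 \<theta>))"
    unfolding C2_data_def
  proof (intro ballI conjI)
    fix x assume x: "x \<in> latitudes"
    have d: "((\<lambda>\<theta>. complex_of_real (u \<theta>)) has_vector_derivative of_real u') (at x)"
      if "(u has_vector_derivative u') (at x)" for u u'
      using that
      by (intro has_vector_derivative_of_real) (simp add: has_real_derivative_iff_has_vector_derivative)
    have "((\<lambda>\<theta>. complex_of_real (H \<theta>)) has_vector_derivative of_real (H1 x)) (at x)"
      using assms(2) x by (intro d) (simp add: C2_data_def)
    then show "(G has_vector_derivative of_real (H1 x)) (at x)"
      by (rule has_vector_derivative_transform_within_open[OF _ _ x]) (auto simp: G)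
    show "((\<lambda>\<theta>. complex_of_real (H1 \<theta>)) has_vector_derivative of_real (H2 x)) (at x)"
      using assms(2) x by (intro d) (simp add: C2_data_def)
  qed
  moreover have z: "C2_data (\<lambda>_. 0) (\<lambda>_. 0) (\<lambda>_. 0 :: complex)" by (simp add: C2_data_def)
  moreover have "F = modes 0 G (\<lambda>_. 0) (\<lambda>_. 0)" by (simp add: assms(5) modes_def fun_eq_iff)
  ultimately show ?thesis
    using LB_modes[OF assms(1) _ z z assms(4), of G "\<lambda>\<theta>. of_real (H1 \<theta>)" "\<lambda>\<theta>. of_real (H2 \<theta>)" 0]
    by (simp add: modes_def zonal_LB_def scaleR_conv_of_real)
qed

text \<open>Membership concerns all points and needs an ambient extension, while \<open>H\<close> is
  controlled only between the poles. The member produced is therefore L(sin \<theta>), with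
  \<open>L\<close> the extension of H(arcsin s) past s = -1 and s = 1.\<close>

lemma zonal_solution_in_eigenspace:
  fixes H H1 H2 :: "real \<Rightarrow> real"
  assumes b: "0 < b" "b < 1"
    and H: "C2_data H H1 H2"
    and eq: "\<And>\<theta>. \<theta> \<in> latitudes \<Longrightarrow> zonal_LB b H1 H2 \<theta> + lam * H \<theta> = 0"
    and lim: "(H1 \<longlongrightarrow> 0) (at_left (pi / 2))" "(H1 \<longlongrightarrow> 0) (at_right (- pi / 2))"
  obtains G where "(\<lambda>p. G (snd p)) \<in> eigenspace_LB b lam" "\<And>\<theta>. \<theta> \<in> latitudes \<Longrightarrow> G \<theta> = complex_of_real (H \<theta>)"
proof -
  have dH: "(H has_real_derivative H1 \<theta>) (at \<theta>)" "(H1 has_real_derivative H2 \<theta>) (at \<theta>)" if "\<theta> \<in> latitudes" for \<theta>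
    using H that by (auto simp: C2_data_def has_real_derivative_iff_has_vector_derivative)
  define C where "C = (\<lambda>s::real. sqrt (1 - s\<^sup>2))"
  define K where "K = (\<lambda>s. H (arcsin s))"
  define K1 where "K1 = (\<lambda>s. H1 (arcsin s) / C s)"
  define K2 where "K2 = (\<lambda>s. (H2 (arcsin s) + s * K1 s) / (C s)\<^sup>2)"
  have S: "arcsin s \<in> latitudes" "0 < C s" "(C s)\<^sup>2 = 1 - s\<^sup>2" "cos (arcsin s) = C s" "sin (arcsin s) = s"
    "(arcsin has_real_derivative inverse (C s)) (at s)"
    if "s \<in> {-1<..<1}" for s
  proof -
    have "\<bar>s\<bar> < 1" using that by auto
    then have s2: "s\<^sup>2 < 1" by (simp add: abs_square_less_1)
    show "arcsin s \<in> latitudes" using arcsin_lt_bounded[of s] that by auto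
    show "0 < C s" "(C s)\<^sup>2 = 1 - s\<^sup>2" using s2 by (simp_all add: C_def)
    show "cos (arcsin s) = C s" "sin (arcsin s) = s" using that by (simp_all add: C_def cos_arcsin)
    show "(arcsin has_real_derivative inverse (C s)) (at s)"
      unfolding C_def using that by (intro DERIV_arcsin) auto
  qed
  have K: "(K has_real_derivative K1 s) (at s)" if s: "s \<in> {-1<..<1}" for s
    using DERIV_chain2[OF dH(1)[OF S(1)[OF s]] S(6)[OF s]] by (simp add: K_def K1_def divide_inverse)
  have K1: "(K1 has_real_derivative K2 s) (at s)" if s: "s \<in> {-1<..<1}" for s
  proof -
    have s2: "0 < 1 - s\<^sup>2" using S(2,3)[OF s] by (metis zero_less_power)
    have "((\<lambda>s. 1 - s\<^sup>2) has_real_derivative - 2 * s) (at s)" by (auto intro!: derivative_eq_intros)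
    from DERIV_chain2[where f = sqrt and g = "\<lambda>s. 1 - s\<^sup>2", OF DERIV_real_sqrt[OF s2] this]
    have dC: "(C has_real_derivative inverse (C s) / 2 * (- 2 * s)) (at s)" by (simp add: C_def)
    have "((\<lambda>s. H1 (arcsin s)) has_real_derivative H2 (arcsin s) * inverse (C s)) (at s)"
      using DERIV_chain2[OF dH(2)[OF S(1)[OF s]] S(6)[OF s]] .
    from DERIV_divide[OF this dC] S(2)[OF s]
    have "(K1 has_real_derivative (H2 (arcsin s) * inverse (C s) * C s - H1 (arcsin s) * (inverse (C s) / 2 * (- 2 * s)))
        / (C s * C s)) (at s)"
      unfolding K1_def by simp
    moreover have "(H2 (arcsin s) * inverse (C s) * C s - H1 (arcsin s) * (inverse (C s) / 2 * (- 2 * s))) / (C s * C s) = K2 s"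
      using S(2)[OF s] by (simp add: K2_def K1_def power2_eq_square field_simps)
    ultimately show ?thesis by simp
  qed
  have ode: "(1 - s\<^sup>2) * profile_R b s * K2 s = profile_u b s * K1 s - lam * (profile_R b s)\<^sup>2 * K s"
    if s: "s \<in> {-1<..<1}" for s
  proof -
    define R where "R = profile_R b s"
    have R: "0 < R" using profile_R_pos[OF b] by (simp add: R_def)
    have rho2: "(rho b (arcsin s))\<^sup>2 = R" by (simp add: rho_profile_R S[OF s] R_def)
    then have i2: "(inverse (rho b (arcsin s)))\<^sup>2 = inverse R" by (simp add: power_inverse)
    have "inverse (rho b (arcsin s)) ^ 4 = ((inverse (rho b (arcsin s)))\<^sup>2)\<^sup>2" by simp
    then have i4: "inverse (rho b (arcsin s)) ^ 4 = (inverse R)\<^sup>2" unfolding i2 .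
    have "inverse R * H2 (arcsin s)
        + (- (s * inverse (C s)) * inverse R - (1 - b\<^sup>2) * s * C s * (inverse R)\<^sup>2) * H1 (arcsin s) + lam * K s = 0"
      using eq[OF S(1)[OF s]] by (simp add: zonal_LB_def drift_def i2 i4 S[OF s] K_def)
    \<comment> \<open>Multiplying by R^2 clears the powers of \<rho>, and H1 = C K1 removes the
      square root C, leaving polynomial coefficients.\<close>
    then have "R\<^sup>2 * (inverse R * H2 (arcsin s)
        + (- (s * inverse (C s)) * inverse R - (1 - b\<^sup>2) * s * C s * (inverse R)\<^sup>2) * H1 (arcsin s) + lam * K s) = 0"
      by simp
    moreover have "R\<^sup>2 * (inverse R * H2 (arcsin s)
        + (- (s * inverse (C s)) * inverse R - (1 - b\<^sup>2) * s * C s * (inverse R)\<^sup>2) * H1 (arcsin s) + lam * K s)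
      = R * H2 (arcsin s) - (s * R + (1 - b\<^sup>2) * s * (C s)\<^sup>2) * K1 s + lam * R\<^sup>2 * K s"
      using R S(2)[OF s] by (simp add: K1_def power2_eq_square field_simps)
    ultimately have H2: "R * H2 (arcsin s) = (s * R + (1 - b\<^sup>2) * s * (1 - s\<^sup>2)) * K1 s - lam * R\<^sup>2 * K s"
      unfolding S(3)[OF s] by linarith
    have "(1 - s\<^sup>2) * R * K2 s = R * (H2 (arcsin s) + s * K1 s)"
      using S(2)[OF s] unfolding K2_def S(3)[OF s, symmetric] by simp
    also have "\<dots> = R * H2 (arcsin s) + R * s * K1 s" by (simp add: algebra_simps)
    finally have "(1 - s\<^sup>2) * R * K2 s = R * H2 (arcsin s) + R * s * K1 s" .
    then show ?thesis unfolding profile_u_def R_def[symmetric] H2 by (simp add: algebra_simps)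
  qed
  \<comment> \<open>The south pole is reduced to the north pole by the reflection \<theta> ->
    -\<theta>.\<close>
  have mirror: "((\<lambda>\<theta>. H (- \<theta>)) has_real_derivative - H1 (- \<theta>)) (at \<theta>)" if "\<theta> \<in> latitudes" for \<theta>
    using DERIV_chain2[OF dH(1)[of "- \<theta>"] DERIV_minus[OF DERIV_ident]] that by simp
  have mlim: "((\<lambda>\<theta>. - H1 (- \<theta>)) \<longlongrightarrow> 0) (at_left (pi / 2))"
    using tendsto_minus[OF lim(2)] unfolding at_left_minus[of "pi / 2"] filterlim_filtermap by simp
  have limits: "((\<lambda>t. t * K (\<sigma> * (1 - t))) \<longlongrightarrow> 0) (at_right 0)"
      "((\<lambda>t. t * K1 (\<sigma> * (1 - t))) \<longlongrightarrow> 0) (at_right 0)" if "\<sigma> = 1 \<or> \<sigma> = -1" for \<sigma>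
  proof -
    have ev01: "\<forall>\<^sub>F t in at_right 0. t \<in> {0<..<1::real}" by (rule eventually_at_right_real) simp
    from that have "((\<lambda>t. t * K (\<sigma> * (1 - t))) \<longlongrightarrow> 0) (at_right 0) \<and>
      ((\<lambda>t. t * K1 (\<sigma> * (1 - t))) \<longlongrightarrow> 0) (at_right 0)"
    proof
      assume "\<sigma> = 1"
      then show ?thesis using limit_at_north_pole[OF dH(1) lim(1)] by (simp add: K_def K1_def C_def)
    next
      assume \<sigma>: "\<sigma> = -1"
      have arc: "arcsin (t - 1) = - arcsin (1 - t)" if "t \<in> {0<..<1}" for t :: real
        using arcsin_minus[of "1 - t"] that by simp
      have "((\<lambda>t. t * K (\<sigma> * (1 - t))) \<longlongrightarrow> 0) (at_right 0)"
        by (rule Lim_transform_eventually[OF limit_at_north_pole(1)[OF mirror mlim]], assumption, rule eventually_mono[OF ev01])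
           (simp add: K_def \<sigma> arc)
      \<comment> \<open>The reflected function has derivative \<open>- H1 (- \<theta>)\<close>; the
        outer minus undoes this sign to recover \<open>K1\<close>.\<close>
      moreover have "((\<lambda>t. - (t * (- H1 (- arcsin (1 - t)) / sqrt (1 - (1 - t)\<^sup>2)))) \<longlongrightarrow> 0) (at_right 0)"
        using tendsto_minus[OF limit_at_north_pole(2)[OF mirror mlim]] by simp
      then have "((\<lambda>t. t * K1 (\<sigma> * (1 - t))) \<longlongrightarrow> 0) (at_right 0)"
      proof (rule Lim_transform_eventually, intro eventually_mono[OF ev01])
        fix t :: real assume t: "t \<in> {0<..<1}"
        have "C (t - 1) = sqrt (1 - (1 - t)\<^sup>2)" unfolding C_def by (simp only: power2_commute)
        then have "K1 (t - 1) = H1 (- arcsin (1 - t)) / sqrt (1 - (1 - t)\<^sup>2)"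
          unfolding K1_def arc[OF t] by simp
        then show "- (t * (- H1 (- arcsin (1 - t)) / sqrt (1 - (1 - t)\<^sup>2))) = t * K1 (\<sigma> * (1 - t))"
          by (simp add: \<sigma>)
      qed
      ultimately show ?thesis by blast
    qed
    then show "((\<lambda>t. t * K (\<sigma> * (1 - t))) \<longlongrightarrow> 0) (at_right 0)"
      "((\<lambda>t. t * K1 (\<sigma> * (1 - t))) \<longlongrightarrow> 0) (at_right 0)" by blast+
  qed
  have h: "bounded_linear (\<lambda>q :: real \<times> real \<times> real. snd (snd q) / b)"
    by (intro bounded_linear_compose[OF bounded_linear_divide] bounded_linear_compose[OF bounded_linear_snd bounded_linear_snd])
  obtain L T where L: "open T" "{-1..1} \<subseteq> T" "\<And>s. s \<in> {-1<..<1} \<Longrightarrow> L s = K s"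
    "\<And>n. Ck_on n ((\<lambda>q :: real \<times> real \<times> real. snd (snd q) / b) -` T) (\<lambda>q. complex_of_real (L (snd (snd q) / b)))"
    by (rule profile_extends_past_poles[OF b h K K1 ode limits], assumption+) (rule that)
  define G where "G = (\<lambda>\<theta>. complex_of_real (L (sin \<theta>)))"
  have G: "G \<theta> = complex_of_real (H \<theta>)" if \<theta>: "\<theta> \<in> latitudes" for \<theta>
  proof -
    have "\<bar>sin \<theta>\<bar> < 1"
      using cos_latitude_pos[OF \<theta>] sin_cos_squared_add[of \<theta>] abs_square_less_1[of "sin \<theta>"]
      by (smt (verit) zero_less_power)
    then have "L (sin \<theta>) = H (arcsin (sin \<theta>))" using L(3)[of "sin \<theta>"] by (auto simp: K_def abs_less_iff)
    also have "arcsin (sin \<theta>) = \<theta>" using \<theta> by (intro arcsin_sin) auto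
    finally show ?thesis by (simp add: G_def)
  qed
  have "(\<lambda>p. G (snd p)) \<in> eigenspace_LB b lam"
    unfolding eigenspace_LB_def
  proof (intro CollectI conjI allI impI)
    show "smooth_on_ellipsoid b (\<lambda>p. G (snd p))"
      unfolding G_def by (rule smooth_on_ellipsoid_profile[OF b(1) L(1,2,4)])
    fix p :: "real \<times> real" assume p: "snd p \<in> latitudes"
    have "LB b (\<lambda>p. G (snd p)) p = of_real (zonal_LB b H1 H2 (snd p))"
      by (rule LB_zonal[OF b(1) H _ p refl]) (simp add: G)
    moreover have "zonal_LB b H1 H2 (snd p) = - lam * H (snd p)" using eq[OF p] by simp
    ultimately show "- LB b (\<lambda>p. G (snd p)) p = of_real lam * G (snd p)" using G[OF p] by simp
  qed
  then show ?thesis using that G by blast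
qed

subsection \<open>The Euler equation along a latitude\<close>

lemma C1_differentiable_on_realI:
  fixes f :: "real \<Rightarrow> real"
  assumes "\<And>x. x \<in> S \<Longrightarrow> (f has_real_derivative D x) (at x)" "continuous_on S D"
  shows "f C1_differentiable_on S"
  unfolding C1_differentiable_on_def
  by (intro exI[of _ D] conjI ballI)
     (simp_all add: assms has_real_derivative_iff_has_vector_derivative[symmetric])

lemma C1_differentiable_on_inverse:
  fixes f :: "real \<Rightarrow> real"
  assumes "f C1_differentiable_on S" and nz: "\<And>x. x \<in> S \<Longrightarrow> f x \<noteq> 0"
  shows "(\<lambda>x. inverse (f x)) C1_differentiable_on S"
proof -
  obtain D where "\<forall>x\<in>S. (f has_vector_derivative D x) (at x)" and cD: "continuous_on S D"
    using assms(1) unfolding C1_differentiable_on_def by blast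
  then have D: "(f has_real_derivative D x) (at x)" if "x \<in> S" for x
    using that by (simp add: has_real_derivative_iff_has_vector_derivative)
  have cf: "continuous_on S f"
    by (intro continuous_at_imp_continuous_on ballI) (rule DERIV_isCont[OF D])
  show ?thesis
  proof (rule C1_differentiable_on_realI)
    show "((\<lambda>x. inverse (f x)) has_real_derivative - (inverse (f x) * D x * inverse (f x))) (at x)" if "x \<in> S" for x
      by (rule DERIV_inverse'[OF D[OF that] nz[OF that]])
    show "continuous_on S (\<lambda>x. - (inverse (f x) * D x * inverse (f x)))"
      by (intro continuous_intros cf cD ballI nz)
  qed
qed

lemma C1_trig: "(sin :: real \<Rightarrow> real) C1_differentiable_on S" "(cos :: real \<Rightarrow> real) C1_differentiable_on S"
  by (rule C1_differentiable_on_realI, rule DERIV_sin DERIV_cos, intro continuous_intros)+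

lemma continuous_on_rho:
  assumes "0 < b"
  shows "continuous_on S (rho b)"
  by (intro continuous_at_imp_continuous_on ballI) (rule DERIV_isCont[OF rho_has_derivative[OF assms]])

lemma C1_inverse_rho:
  assumes "0 < b"
  shows "(\<lambda>x. inverse (rho b x)) C1_differentiable_on S"
proof (rule C1_differentiable_on_inverse)
  have "continuous_on S (\<lambda>\<theta>. (1 - b\<^sup>2) * sin \<theta> * cos \<theta> / rho b \<theta>)"
    using rho_pos[OF assms] by (intro continuous_intros continuous_on_rho[OF assms]) (simp add: less_imp_neq[symmetric])
  then show "rho b C1_differentiable_on S"
    by (rule C1_differentiable_on_realI[OF rho_has_derivative[OF assms]])
  show "rho b x \<noteq> 0" for x using rho_pos[OF assms, of x] by simp
qed

text \<open>Needed for a continuous derivative of the zonal vorticity, so that an identity valid off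
  the zeros of a mode extends across them.\<close>

lemma C1_drift:
  assumes "0 < b"
  shows "drift b C1_differentiable_on latitudes"
proof -
  have "(\<lambda>x::real. inverse (cos x)) C1_differentiable_on latitudes"
    by (intro C1_differentiable_on_inverse C1_trig) (metis cos_latitude_pos less_irrefl)
  then have "(\<lambda>\<theta>. (-1) * (sin \<theta> * inverse (cos \<theta>)) * (inverse (rho b \<theta>) * inverse (rho b \<theta>))
     - (1 - b\<^sup>2) * (sin \<theta> * (cos \<theta> * ((inverse (rho b \<theta>) * inverse (rho b \<theta>)) * (inverse (rho b \<theta>) * inverse (rho b \<theta>))))))
     C1_differentiable_on latitudes"
    by (intro C1_differentiable_on_diff C1_differentiable_on_mult C1_differentiable_on_const C1_trig C1_inverse_rho assms)
  moreover have "drift b = (\<lambda>\<theta>. (-1) * (sin \<theta> * inverse (cos \<theta>)) * (inverse (rho b \<theta>) * inverse (rho b \<theta>))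
     - (1 - b\<^sup>2) * (sin \<theta> * (cos \<theta> * ((inverse (rho b \<theta>) * inverse (rho b \<theta>)) * (inverse (rho b \<theta>) * inverse (rho b \<theta>))))))"
    by (simp add: fun_eq_iff drift_def power2_eq_square power4_eq_xxxx)
  ultimately show ?thesis by simp
qed

text \<open>Separation of variables leaves A'' = p A' + q A. Because the square of \<kappa> is real,
  p and q are real, so real and imaginary parts can be treated separately by
  \<open>second_order_ode_unique\<close>.\<close>

lemma eigenmode_unique:
  assumes b: "0 < b" and \<kappa>: "\<kappa>\<^sup>2 = complex_of_real \<mu>"
    and A: "C2_data A A' A''"
    and eig: "\<And>p. snd p \<in> latitudes \<Longrightarrow>
      - LB b (modes \<kappa> (\<lambda>_. 0) A (\<lambda>_. 0)) p = of_real lam * modes \<kappa> (\<lambda>_. 0) A (\<lambda>_. 0) p"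
    and x0: "x0 \<in> latitudes" "A x0 = 0" "A' x0 = 0" and x: "x \<in> latitudes"
  shows "A x = 0"
proof -
  define p where "p = (\<lambda>\<theta>. - ((rho b \<theta>)\<^sup>2 * drift b \<theta>))"
  define q where "q = (\<lambda>\<theta>. - ((rho b \<theta>)\<^sup>2 * (lam + \<mu> * inverse (cos \<theta> * cos \<theta>))))"
  have rho: "rho b \<theta> \<noteq> 0" for \<theta> using rho_pos[OF b, of \<theta>] by simp
  have z: "C2_data (\<lambda>_. 0) (\<lambda>_. 0) (\<lambda>_. 0 :: complex)" by (simp add: C2_data_def)
  have ode: "A'' \<theta> = p \<theta> *\<^sub>R A' \<theta> + q \<theta> *\<^sub>R A \<theta>" if \<theta>: "\<theta> \<in> latitudes" for \<theta>
  proof -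
    have c: "cos \<theta> \<noteq> 0" using cos_latitude_pos[OF \<theta>] by simp
    \<comment> \<open>At longitude 0 the exponential is 1, so this evaluation reads off the equation
      for the coefficient.\<close>
    have "LB b (modes \<kappa> (\<lambda>_. 0) A (\<lambda>_. 0)) (0, \<theta>) = zonal_LB b A' A'' \<theta> + \<kappa>\<^sup>2 * A \<theta> / of_real ((cos \<theta>)\<^sup>2)"
      using \<theta> by (subst LB_modes[OF b z A z]) (simp_all add: modes_def zonal_LB_def)
    moreover have "- LB b (modes \<kappa> (\<lambda>_. 0) A (\<lambda>_. 0)) (0, \<theta>) = of_real lam * A \<theta>"
      using eig[of "(0, \<theta>)"] \<theta> by (simp add: modes_def)
    ultimately have "zonal_LB b A' A'' \<theta> + \<kappa>\<^sup>2 * A \<theta> / of_real ((cos \<theta>)\<^sup>2) + of_real lam * A \<theta> = 0"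
      by (metis add.commute add.right_inverse)
    moreover have "\<kappa>\<^sup>2 * A \<theta> / of_real ((cos \<theta>)\<^sup>2) = (\<mu> * inverse (cos \<theta> * cos \<theta>)) *\<^sub>R A \<theta>"
      unfolding \<kappa> using c by (simp add: scaleR_conv_of_real power2_eq_square field_simps)
    ultimately have e: "zonal_LB b A' A'' \<theta> = - ((lam + \<mu> * inverse (cos \<theta> * cos \<theta>)) *\<^sub>R A \<theta>)"
      by (simp only: eq_neg_iff_add_eq_0 scaleR_add_left) (simp add: scaleR_conv_of_real add_ac)
    have "A'' \<theta> = (rho b \<theta>)\<^sup>2 *\<^sub>R ((inverse (rho b \<theta>))\<^sup>2 *\<^sub>R A'' \<theta>)"
      using rho[of \<theta>] by (simp add: power_inverse)
    also have "(inverse (rho b \<theta>))\<^sup>2 *\<^sub>R A'' \<theta> = zonal_LB b A' A'' \<theta> - drift b \<theta> *\<^sub>R A' \<theta>"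
      by (simp add: zonal_LB_def)
    finally show ?thesis unfolding e p_def q_def by (simp add: scaleR_diff_right)
  qed
  have C1c: "continuous_on S f" if "f C1_differentiable_on S" for f :: "real \<Rightarrow> real" and S
    using C1_diff_imp_diff[OF that] by (rule differentiable_imp_continuous_on)
  note cr = continuous_on_rho[OF b, of latitudes]
  have cp: "continuous_on latitudes p"
    unfolding p_def by (intro continuous_intros cr C1c[OF C1_drift[OF b]])
  have cq: "continuous_on latitudes q"
    unfolding q_def by (intro continuous_intros cr) (metis cos_latitude_pos less_irrefl mult_eq_0_iff)
  have "Re (A x) = 0"
  proof (rule second_order_ode_unique[OF _ _ _ cp cq x0(1) _ _ x, of "\<lambda>x. Re (A x)" "\<lambda>x. Re (A' x)" "\<lambda>x. Re (A'' x)"])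
    fix \<theta> assume \<theta>: "\<theta> \<in> latitudes"
    show "((\<lambda>x. Re (A x)) has_real_derivative Re (A' \<theta>)) (at \<theta>)" "((\<lambda>x. Re (A' x)) has_real_derivative Re (A'' \<theta>)) (at \<theta>)"
      using A \<theta> unfolding C2_data_def has_real_derivative_iff_has_vector_derivative
      by (auto intro!: bounded_linear.has_vector_derivative[OF bounded_linear_Re])
    show "Re (A'' \<theta>) = p \<theta> * Re (A' \<theta>) + q \<theta> * Re (A \<theta>)" using ode[OF \<theta>] by simp
  qed (use x0 in auto)
  moreover have "Im (A x) = 0"
  proof (rule second_order_ode_unique[OF _ _ _ cp cq x0(1) _ _ x, of "\<lambda>x. Im (A x)" "\<lambda>x. Im (A' x)" "\<lambda>x. Im (A'' x)"])
    fix \<theta> assume \<theta>: "\<theta> \<in> latitudes"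
    show "((\<lambda>x. Im (A x)) has_real_derivative Im (A' \<theta>)) (at \<theta>)" "((\<lambda>x. Im (A' x)) has_real_derivative Im (A'' \<theta>)) (at \<theta>)"
      using A \<theta> unfolding C2_data_def has_real_derivative_iff_has_vector_derivative
      by (auto intro!: bounded_linear.has_vector_derivative[OF bounded_linear_Im])
    show "Im (A'' \<theta>) = p \<theta> * Im (A' \<theta>) + q \<theta> * Im (A \<theta>)" using ode[OF \<theta>] by simp
  qed (use x0 in auto)
  ultimately show ?thesis by (simp add: complex_eq_iff)
qed

text \<open>Where \<open>k\<close> is nonzero it stays nonzero on an open set, so \<open>A\<close>
  vanishes there together with \<open>A'\<close>. Uniqueness then makes \<open>A\<close> vanish on
  all of \<open>S\<close>, against the point \<open>y\<close>.\<close>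

lemma continuous_zero_of_zero_where_nonvanishing:
  fixes k :: "real \<Rightarrow> real" and A A' :: "real \<Rightarrow> 'a::real_normed_vector"
  assumes "open S" and k: "continuous_on S k" "\<And>x. x \<in> S \<Longrightarrow> A x \<noteq> 0 \<Longrightarrow> k x = 0"
    and A: "\<And>x. x \<in> S \<Longrightarrow> (A has_vector_derivative A' x) (at x)"
    and uniq: "\<And>x y. x \<in> S \<Longrightarrow> A x = 0 \<Longrightarrow> A' x = 0 \<Longrightarrow> y \<in> S \<Longrightarrow> A y = 0"
    and y: "y \<in> S" "A y \<noteq> 0" and x: "x \<in> S"
  shows "k x = 0"
proof (rule ccontr)
  assume "k x \<noteq> 0"
  define V where "V = S \<inter> k -` (- {0})"
  have V: "open V" unfolding V_def using continuous_open_preimage[OF k(1) \<open>open S\<close>] by (simp add: open_Compl)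
  have x: "x \<in> V" using x \<open>k x \<noteq> 0\<close> by (simp add: V_def)
  have A0: "A z = 0" if "z \<in> V" for z using k(2)[of z] that by (auto simp: V_def)
  have "((\<lambda>_. 0) has_vector_derivative A' x) (at x)"
    by (rule has_vector_derivative_transform_within_open[OF A V x]) (use x A0 in \<open>auto simp: V_def\<close>)
  then have "A' x = 0" using vector_derivative_unique_at[OF _ has_vector_derivative_const] by blast
  then show False using uniq[of x y] x A0[OF x] y by (auto simp: V_def)
qed

text \<open>The Euler equation at a fixed latitude is a factor independent of longitude times the
  longitude derivative of \<open>Y\<close>. A nonzero factor would make that derivative vanish all
  along the latitude circle, and \<open>modes_zonal_imp_zero\<close> would then kill both
  coefficients.\<close>

lemma stationary_euler_latitude:
  fixes g g1 g2 h :: "real \<Rightarrow> real"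
  assumes b: "0 < b" and m: "m \<noteq> 0" and \<kappa>: "\<kappa> = \<i> * of_int m"
    and A: "C2_data A A' A''" and B: "C2_data B B' B''"
    and Y: "Y = modes \<kappa> (\<lambda>_. 0) A B"
    and eig: "\<And>p. snd p \<in> latitudes \<Longrightarrow> - LB b Y p = of_real lam * Y p"
    and g: "C2_data g g1 g2"
    and h: "h = (\<lambda>x. zonal_LB b g1 g2 x + 2 * \<omega> * sin x / rho b x)" "(h has_real_derivative h') (at \<theta>)"
    and euler: "stationary_euler b \<omega> (\<lambda>p. of_real (g (snd p)) + Y p)"
    and \<theta>: "\<theta> \<in> latitudes" and nz: "A \<theta> \<noteq> 0 \<or> B \<theta> \<noteq> 0"
  shows "lam * g1 \<theta> + h' = 0"
proof (rule ccontr)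
  assume contra: "lam * g1 \<theta> + h' \<noteq> 0"
  let ?cg = "\<lambda>x. complex_of_real (g x)" and ?cg1 = "\<lambda>x. complex_of_real (g1 x)" and ?cg2 = "\<lambda>x. complex_of_real (g2 x)"
  define \<psi> where "\<psi> = modes \<kappa> ?cg A B"
  have \<psi>: "(\<lambda>p. of_real (g (snd p)) + Y p) = \<psi>" by (simp add: Y \<psi>_def modes_def fun_eq_iff)
  have z: "C2_data (\<lambda>_. 0) (\<lambda>_. 0) (\<lambda>_. 0 :: complex)" by (simp add: C2_data_def)
  have cg: "C2_data ?cg ?cg1 ?cg2"
    using g by (auto simp: C2_data_def has_real_derivative_iff_has_vector_derivative[symmetric] intro!: has_vector_derivative_of_real)
  define W where "W = (\<lambda>p. LB b \<psi> p + of_real (2 * \<omega> * sin (snd p) / rho b (snd p)))"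
  define Wm where "Wm = modes \<kappa> (\<lambda>x. of_real (h x)) (\<lambda>x. - of_real lam * A x) (\<lambda>x. - of_real lam * B x)"
  have W: "W p = Wm p" if p: "snd p \<in> latitudes" for p
  proof -
    have "LB b \<psi> p = of_real (zonal_LB b g1 g2 (snd p)) + LB b Y p"
      unfolding \<psi>_def Y LB_modes[OF b cg A B p] LB_modes[OF b z A B p]
      by (simp add: modes_def zonal_LB_def scaleR_conv_of_real)
    moreover have "LB b Y p = - (of_real lam * Y p)" using eig[OF p] by (metis minus_minus)
    ultimately have "LB b \<psi> p = of_real (zonal_LB b g1 g2 (snd p)) - of_real lam * Y p" by simp
    then show ?thesis
      by (simp add: W_def Wm_def Y modes_def h(1) algebra_simps)
  qed
  have "modes \<kappa> (\<lambda>_. 0) (\<lambda>x. \<kappa> * A x) (\<lambda>x. - \<kappa> * B x) (\<phi>, \<theta>) = 0" for \<phi>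
  proof -
    let ?p = "(\<phi>, \<theta>)"
    have "(\<lambda>s. W (s, \<theta>)) = (\<lambda>s. Wm (s, \<theta>))" using W \<theta> by auto
    then have "dphi W ?p = dphi Wm ?p" by (simp add: dphi_def)
    also have "\<dots> = - of_real lam * modes \<kappa> (\<lambda>_. 0) (\<lambda>x. \<kappa> * A x) (\<lambda>x. - \<kappa> * B x) ?p"
      unfolding Wm_def dphi_modes by (simp add: modes_def algebra_simps)
    finally have dW: "dphi W ?p = - of_real lam * modes \<kappa> (\<lambda>_. 0) (\<lambda>x. \<kappa> * A x) (\<lambda>x. - \<kappa> * B x) ?p" .
    have lin: "((\<lambda>x. - of_real lam * f x) has_vector_derivative - of_real lam * f') (at \<theta>)"
      if "(f has_vector_derivative f') (at \<theta>)" for f :: "real \<Rightarrow> complex" and f'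
      using that by (intro has_vector_derivative_mult_right)
    have "((\<lambda>t. Wm (\<phi>, t)) has_vector_derivative
        modes \<kappa> (\<lambda>_. of_real h') (\<lambda>_. - of_real lam * A' \<theta>) (\<lambda>_. - of_real lam * B' \<theta>) ?p) (at \<theta>)"
      unfolding Wm_def using A B \<theta> h(2)
      by (intro modes_has_derivative_theta lin has_vector_derivative_of_real) (auto simp: C2_data_def)
    then have "((\<lambda>t. W (\<phi>, t)) has_vector_derivative
        modes \<kappa> (\<lambda>_. of_real h') (\<lambda>_. - of_real lam * A' \<theta>) (\<lambda>_. - of_real lam * B' \<theta>) ?p) (at \<theta>)"
      by (rule has_vector_derivative_transform_within_open[OF _ _ \<theta>]) (auto simp: W)
    then have "dtheta W ?p = modes \<kappa> (\<lambda>_. of_real h') (\<lambda>_. - of_real lam * A' \<theta>) (\<lambda>_. - of_real lam * B' \<theta>) ?p"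
      by (simp add: dtheta_def vector_derivative_at)
    then have tW: "dtheta W ?p = of_real h' - of_real lam * modes \<kappa> (\<lambda>_. 0) A' B' ?p"
      by (simp add: modes_def algebra_simps)
    have "dtheta \<psi> ?p = modes \<kappa> ?cg1 A' B' ?p"
      unfolding \<psi>_def using \<theta> by (intro dtheta_modes[OF cg A B]) simp
    then have t\<psi>: "dtheta \<psi> ?p = of_real (g1 \<theta>) + modes \<kappa> (\<lambda>_. 0) A' B' ?p" by (simp add: modes_def)
    have d\<psi>: "dphi \<psi> ?p = modes \<kappa> (\<lambda>_. 0) (\<lambda>x. \<kappa> * A x) (\<lambda>x. - \<kappa> * B x) ?p"
      by (simp only: \<psi>_def dphi_modes)
    have "- dtheta \<psi> ?p * dphi W ?p + dphi \<psi> ?p * dtheta W ?p = 0"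
      using euler \<theta> unfolding \<psi> stationary_euler_def Let_def W_def[symmetric] by simp
    \<comment> \<open>The two products of derivatives of \<open>Y\<close> carry the factor
      \<open>lam\<close> with opposite signs and cancel.\<close>
    then have "(of_real (lam * g1 \<theta> + h')) * modes \<kappa> (\<lambda>_. 0) (\<lambda>x. \<kappa> * A x) (\<lambda>x. - \<kappa> * B x) ?p = 0"
      unfolding dW tW t\<psi> d\<psi> by (simp add: algebra_simps)
    then show ?thesis using contra by (metis mult_eq_0_iff of_real_eq_0_iff)
  qed
  from modes_zonal_imp_zero(2)[OF m this[symmetric, unfolded \<kappa>]]
  show False using nz m by simp
qed

lemma C2_data_of_C3alpha:
  assumes "C3alpha \<alpha> latitudes g"
  shows "C2_data g (deriv g) (deriv (deriv g))" "deriv (deriv g) C1_differentiable_on latitudes"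
proof -
  have k: "((deriv ^^ k) g has_real_derivative (deriv ^^ Suc k) g x) (at x)" if "k < 3" "x \<in> latitudes" for k x
    using assms that unfolding C3alpha_def by blast
  show "C2_data g (deriv g) (deriv (deriv g))"
    unfolding C2_data_def has_real_derivative_iff_has_vector_derivative[symmetric]
    using k[of 0] k[of 1] by simp
  have "continuous_on latitudes ((deriv ^^ 3) g)" using assms unfolding C3alpha_def by blast
  then have "continuous_on latitudes (deriv (deriv (deriv g)))" by (simp add: numeral_eq_Suc)
  moreover have "(deriv (deriv g) has_real_derivative deriv (deriv (deriv g)) x) (at x)" if "x \<in> latitudes" for x
    using k[of 2] that by (simp add: numeral_eq_Suc)
  ultimately show "deriv (deriv g) C1_differentiable_on latitudes"
    by (intro C1_differentiable_on_realI) auto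
qed

text \<open>If \<open>y\<close> were zero on the open strip, the integrand would vanish at every
  point of the rectangle, on its edges because the density contains cos \<theta>. The integral is
  then 0 with no argument about null sets.\<close>

lemma L2_normalized_nonvanishing:
  assumes "L2_inner b (\<lambda>p. y (snd p) * e p) (\<lambda>p. y (snd p) * e p) = 1"
  shows "\<exists>\<theta>\<in>latitudes. y \<theta> \<noteq> 0"
proof (rule ccontr)
  assume "\<not> ?thesis"
  then have y: "y \<theta> = 0" if "\<theta> \<in> latitudes" for \<theta> using that by blast
  have "indicator ({-pi..pi} \<times> {-pi/2..pi/2}) p *\<^sub>R
      (y (snd p) * e p * cnj (y (snd p) * e p) * complex_of_real (cos (snd p) * rho b (snd p))) = 0" for p
  proof (cases "snd p \<in> latitudes")
    case True
    then show ?thesis by (simp add: y)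
  next
    case False
    then have edge: "snd p = pi / 2 \<or> snd p = - (pi / 2)" if "p \<in> {-pi..pi} \<times> {-pi/2..pi/2}"
      using that by (auto simp: mem_Times_iff)
    then have "cos (snd p) = 0" if "p \<in> {-pi..pi} \<times> {-pi/2..pi/2}" using edge[OF that] by (elim disjE) (simp_all only: cos_minus cos_pi_half)
    then show ?thesis by (auto simp: indicator_def)
  qed
  then have "L2_inner b (\<lambda>p. y (snd p) * e p) (\<lambda>p. y (snd p) * e p) = 0"
    unfolding L2_inner_def set_lebesgue_integral_def by (simp only: Bochner_Integration.integral_zero)
  then show False using assms by simp
qed



theorem theorem3:
  fixes b \<omega> \<alpha> lam :: real and l :: nat and m :: int
    and y1 y2 :: "real \<Rightarrow> complex" and Y :: "real \<times> real \<Rightarrow> complex"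
    and g1 g2 :: "real \<Rightarrow> real"
  assumes b: "0 < b" "b < 1"
    and alpha: "0 < \<alpha>" "\<alpha> < 1"
    and m: "m \<noteq> 0" "\<bar>m\<bar> \<le> int l"
    and y_smooth: "Cinf_on {-pi/2<..<pi/2} y1" "Cinf_on {-pi/2<..<pi/2} y2"
    and E_basis: "eigenspace_LB b lam =
        {(\<lambda>p. c1 * y1 (snd p) * exp (\<i> * of_int m * of_real (fst p))
             + c2 * y2 (snd p) * exp (- \<i> * of_int m * of_real (fst p))) | c1 c2. True}"
    and ON: "L2_inner b (\<lambda>p. y1 (snd p) * exp (\<i> * of_int m * of_real (fst p)))
                        (\<lambda>p. y1 (snd p) * exp (\<i> * of_int m * of_real (fst p))) = 1"
            "L2_inner b (\<lambda>p. y2 (snd p) * exp (- \<i> * of_int m * of_real (fst p)))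
                        (\<lambda>p. y2 (snd p) * exp (- \<i> * of_int m * of_real (fst p))) = 1"
            "L2_inner b (\<lambda>p. y1 (snd p) * exp (\<i> * of_int m * of_real (fst p)))
                        (\<lambda>p. y2 (snd p) * exp (- \<i> * of_int m * of_real (fst p))) = 0"
    and Y_in: "Y \<in> eigenspace_LB b lam"
    and Y_nonzero: "\<exists>p. Y p \<noteq> 0"
    and g_reg: "C3alpha \<alpha> {-pi/2<..<pi/2} g1" "C3alpha \<alpha> {-pi/2<..<pi/2} g2"
    and g_lim: "(deriv g1 \<longlongrightarrow> 0) (at_left (pi/2))" "(deriv g1 \<longlongrightarrow> 0) (at_right (-pi/2))"
               "(deriv g2 \<longlongrightarrow> 0) (at_left (pi/2))" "(deriv g2 \<longlongrightarrow> 0) (at_right (-pi/2))"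
    and euler1: "stationary_euler b \<omega> (\<lambda>p. of_real (g1 (snd p)) + Y p)"
    and euler2: "stationary_euler b \<omega> (\<lambda>p. of_real (g2 (snd p)) + Y p)"
  shows "(\<exists>c. \<forall>\<theta>\<in>{-pi/2<..<pi/2}. g1 \<theta> - g2 \<theta> = c) \<and>
         (\<forall>p. snd p \<in> {-pi/2<..<pi/2} \<longrightarrow>
            velocity b (\<lambda>q. of_real (g1 (snd q)) + Y q) p =
            velocity b (\<lambda>q. of_real (g2 (snd q)) + Y q) p)"
proof -
  define \<kappa> where "\<kappa> = \<i> * complex_of_int m"
  have \<kappa>2: "\<kappa>\<^sup>2 = complex_of_real (- (of_int m)\<^sup>2)" "(- \<kappa>)\<^sup>2 = complex_of_real (- (of_int m)\<^sup>2)"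
    by (simp_all add: \<kappa>_def power_mult_distrib)
  have z: "C2_data (\<lambda>_. 0) (\<lambda>_. 0) (\<lambda>_. 0 :: complex)" by (simp add: C2_data_def)
  have E: "eigenspace_LB b lam = {modes \<kappa> (\<lambda>_. 0) (\<lambda>\<theta>. c1 * y1 \<theta>) (\<lambda>\<theta>. c2 * y2 \<theta>) | c1 c2. True}"
    unfolding E_basis by (simp add: modes_def[abs_def] \<kappa>_def)
  have eig: "- LB b F p = of_real lam * F p" if "F \<in> eigenspace_LB b lam" "snd p \<in> latitudes" for F p
    using that unfolding eigenspace_LB_def by blast
  \<comment> \<open>Eigenfunctions contain only the frequencies m and -m in longitude, and m is
    nonzero.\<close>
  have zonal_zero: "G \<theta> = 0" if G: "(\<lambda>p. G (snd p)) \<in> eigenspace_LB b lam" for G \<theta>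
  proof -
    obtain c1 c2 where "(\<lambda>p. G (snd p)) = modes \<kappa> (\<lambda>_. 0) (\<lambda>\<theta>. c1 * y1 \<theta>) (\<lambda>\<theta>. c2 * y2 \<theta>)"
      using G unfolding E by blast
    then have "G \<theta> = modes (\<i> * of_int m) (\<lambda>_. 0) (\<lambda>\<theta>. c1 * y1 \<theta>) (\<lambda>\<theta>. c2 * y2 \<theta>) (\<phi>, \<theta>)" for \<phi>
      unfolding \<kappa>_def by (metis snd_conv)
    then show ?thesis by (rule modes_zonal_imp_zero(1)[OF m(1)])
  qed
  obtain y1' y1'' where y1: "C2_data y1 y1' y1''" using C2_data_of_Cinf[OF y_smooth(1)] by blast
  obtain y2' y2'' where y2: "C2_data y2 y2' y2''" using C2_data_of_Cinf[OF y_smooth(2)] by blast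
  \<comment> \<open>The choices (1, 0) and (0, 1) of coefficients show that each basis function is
    an eigenfunction. The second is rewritten with \<open>- \<kappa>\<close>, so that
    \<open>eigenmode_unique\<close> serves both.\<close>
  have "modes \<kappa> (\<lambda>_. 0) (\<lambda>\<theta>. 1 * y1 \<theta>) (\<lambda>\<theta>. 0 * y2 \<theta>) \<in> eigenspace_LB b lam"
    "modes \<kappa> (\<lambda>_. 0) (\<lambda>\<theta>. 0 * y1 \<theta>) (\<lambda>\<theta>. 1 * y2 \<theta>) \<in> eigenspace_LB b lam"
    unfolding E by blast+
  then have "modes \<kappa> (\<lambda>_. 0) y1 (\<lambda>_. 0) \<in> eigenspace_LB b lam"
    "modes (- \<kappa>) (\<lambda>_. 0) y2 (\<lambda>_. 0) \<in> eigenspace_LB b lam"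
    by (simp_all add: modes_def[abs_def])
  note mode_eig = this[THEN eig]
  have uniq1: "y1 y = 0" if "x \<in> latitudes" "y1 x = 0" "y1' x = 0" "y \<in> latitudes" for x y
    by (rule eigenmode_unique[OF b(1) \<kappa>2(1) y1 mode_eig(1) that])
  have uniq2: "y2 y = 0" if "x \<in> latitudes" "y2 x = 0" "y2' x = 0" "y \<in> latitudes" for x y
    by (rule eigenmode_unique[OF b(1) \<kappa>2(2) y2 mode_eig(2) that])
  obtain \<theta>1 where \<theta>1: "\<theta>1 \<in> latitudes" "y1 \<theta>1 \<noteq> 0" using L2_normalized_nonvanishing[OF ON(1)] by blast
  obtain \<theta>2 where \<theta>2: "\<theta>2 \<in> latitudes" "y2 \<theta>2 \<noteq> 0" using L2_normalized_nonvanishing[OF ON(2)] by blast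
  obtain c1 c2 where Y: "Y = modes \<kappa> (\<lambda>_. 0) (\<lambda>\<theta>. c1 * y1 \<theta>) (\<lambda>\<theta>. c2 * y2 \<theta>)"
    using Y_in unfolding E by blast
  have c: "c1 \<noteq> 0 \<or> c2 \<noteq> 0" using Y_nonzero by (auto simp: Y modes_def)
  have scale: "C2_data (\<lambda>\<theta>. k * y \<theta>) (\<lambda>\<theta>. k * y' \<theta>) (\<lambda>\<theta>. k * y'' \<theta>)" if "C2_data y y' y''"
    for k and y y' y'' :: "real \<Rightarrow> complex"
    using that by (auto simp: C2_data_def intro!: has_vector_derivative_mult_right)
  note A = scale[OF y1, of c1] and B = scale[OF y2, of c2]

  \<comment> \<open>The latitude identity is the derivative of this expression; once it holds on the
    whole strip, integration gives the constant.\<close>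
  have first_integral: "\<exists>c. \<forall>\<theta>\<in>latitudes.
      zonal_LB b (deriv g) (deriv (deriv g)) \<theta> + 2 * \<omega> * sin \<theta> / rho b \<theta> + lam * g \<theta> = c"
    if reg: "C3alpha \<alpha> latitudes g" and euler: "stationary_euler b \<omega> (\<lambda>p. of_real (g (snd p)) + Y p)" for g
  proof -
    note g = C2_data_of_C3alpha[OF reg]
    have dg: "(g has_real_derivative deriv g \<theta>) (at \<theta>)" "(deriv g has_real_derivative deriv (deriv g) \<theta>) (at \<theta>)"
      if "\<theta> \<in> latitudes" for \<theta>
      using g(1) that by (auto simp: C2_data_def has_real_derivative_iff_has_vector_derivative)
    have cont2: "continuous_on latitudes (deriv (deriv g))"
      using C1_diff_imp_diff[OF g(2)] by (rule differentiable_imp_continuous_on)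
    have cont1: "continuous_on latitudes (deriv g)"
      by (intro continuous_at_imp_continuous_on ballI) (rule DERIV_isCont[OF dg(2)])
    define h where "h = (\<lambda>x. zonal_LB b (deriv g) (deriv (deriv g)) x + 2 * \<omega> * sin x / rho b x)"
    have h_eq: "h = (\<lambda>x. inverse (rho b x) * inverse (rho b x) * deriv (deriv g) x + drift b x * deriv g x
        + 2 * \<omega> * (sin x * inverse (rho b x)))"
      by (simp add: h_def zonal_LB_def power2_eq_square field_simps fun_eq_iff)
    have "deriv g C1_differentiable_on latitudes"
      by (rule C1_differentiable_on_realI[OF dg(2) cont2])
    then have "h C1_differentiable_on latitudes"
      unfolding h_eq
      by (intro C1_differentiable_on_add C1_differentiable_on_mult C1_differentiable_on_const C1_trig
          C1_inverse_rho C1_drift b g(2))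
    then obtain h' where "\<forall>x\<in>latitudes. (h has_vector_derivative h' x) (at x)" and ch: "continuous_on latitudes h'"
      unfolding C1_differentiable_on_def by blast
    then have h': "(h has_real_derivative h' x) (at x)" if "x \<in> latitudes" for x
      using that by (simp add: has_real_derivative_iff_has_vector_derivative)
    have nz: "lam * deriv g \<theta> + h' \<theta> = 0" if "\<theta> \<in> latitudes" "c1 * y1 \<theta> \<noteq> 0 \<or> c2 * y2 \<theta> \<noteq> 0" for \<theta>
      using stationary_euler_latitude[OF b(1) m(1) \<kappa>_def A B Y eig[OF Y_in] g(1) h_def h'[OF that(1)] euler that] .
    have ck: "continuous_on latitudes (\<lambda>x. lam * deriv g x + h' x)" by (intro continuous_intros cont1 ch)
    \<comment> \<open>Either mode that occurs in \<open>Y\<close> with a nonzero coefficient can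
      serve as the function whose zeros are crossed.\<close>
    have zero: "lam * deriv g \<theta> + h' \<theta> = 0" if \<theta>: "\<theta> \<in> latitudes" for \<theta>
      using c
    proof
      assume "c1 \<noteq> 0"
      show ?thesis
        by (rule continuous_zero_of_zero_where_nonvanishing[where A = y1 and A' = y1', OF _ ck _ _ uniq1 \<theta>1 \<theta>])
           (use nz y1 \<open>c1 \<noteq> 0\<close> in \<open>auto simp: C2_data_def\<close>)
    next
      assume "c2 \<noteq> 0"
      show ?thesis
        by (rule continuous_zero_of_zero_where_nonvanishing[where A = y2 and A' = y2', OF _ ck _ _ uniq2 \<theta>2 \<theta>])
           (use nz y2 \<open>c2 \<noteq> 0\<close> in \<open>auto simp: C2_data_def\<close>)
    qed
    have "((\<lambda>x. h x + lam * g x) has_real_derivative 0) (at x)" if "x \<in> latitudes" for x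
      using DERIV_add[OF h'[OF that] DERIV_cmult[OF dg(1)[OF that], of lam]] zero[OF that] by (simp add: add.commute)
    then have "\<exists>c. \<forall>x\<in>latitudes. h x + lam * g x = c" by (rule DERIV_zero_const_greaterThanLessThan)
    then show ?thesis by (simp add: h_def)
  qed

  \<comment> \<open>Otherwise the constant 1 would be a nonzero zonal eigenfunction. The value is
    needed as a divisor in \<open>H\<close>.\<close>
  have "lam \<noteq> 0"
  proof
    assume "lam = 0"
    obtain G where G: "(\<lambda>p. G (snd p)) \<in> eigenspace_LB b lam" "\<And>\<theta>. \<theta> \<in> latitudes \<Longrightarrow> G \<theta> = complex_of_real 1"
      by (rule zonal_solution_in_eigenspace[OF b, of "\<lambda>_. 1" "\<lambda>_. 0" "\<lambda>_. 0" lam])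
         (auto simp: C2_data_def zonal_LB_def \<open>lam = 0\<close> intro: that)
    from G(2)[of 0] zonal_zero[OF G(1), of 0] show False by simp
  qed

  obtain k1 where k1: "\<And>\<theta>. \<theta> \<in> latitudes \<Longrightarrow>
      zonal_LB b (deriv g1) (deriv (deriv g1)) \<theta> + 2 * \<omega> * sin \<theta> / rho b \<theta> + lam * g1 \<theta> = k1"
    using first_integral[OF g_reg(1) euler1] by blast
  obtain k2 where k2: "\<And>\<theta>. \<theta> \<in> latitudes \<Longrightarrow>
      zonal_LB b (deriv g2) (deriv (deriv g2)) \<theta> + 2 * \<omega> * sin \<theta> / rho b \<theta> + lam * g2 \<theta> = k2"
    using first_integral[OF g_reg(2) euler2] by blast
  note C1 = C2_data_of_C3alpha(1)[OF g_reg(1)] and C2 = C2_data_of_C3alpha(1)[OF g_reg(2)]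
  \<comment> \<open>The shift absorbs the difference k1 - k2 of the two first integrals and makes
    the equation homogeneous; the terms with \<omega> cancel in the subtraction.\<close>
  define H where "H = (\<lambda>\<theta>. g1 \<theta> - g2 \<theta> - (k1 - k2) / lam)"
  define H1 where "H1 = (\<lambda>\<theta>. deriv g1 \<theta> - deriv g2 \<theta>)"
  define H2 where "H2 = (\<lambda>\<theta>. deriv (deriv g1) \<theta> - deriv (deriv g2) \<theta>)"
  have H: "C2_data H H1 H2"
    using C1 C2 unfolding C2_data_def H_def H1_def H2_def
    by (auto intro!: derivative_eq_intros)
  have Heq: "zonal_LB b H1 H2 \<theta> + lam * H \<theta> = 0" if "\<theta> \<in> latitudes" for \<theta>
  proof -
    have "zonal_LB b H1 H2 \<theta> = zonal_LB b (deriv g1) (deriv (deriv g1)) \<theta> - zonal_LB b (deriv g2) (deriv (deriv g2)) \<theta>"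
      by (simp add: zonal_LB_def H1_def H2_def algebra_simps)
    moreover have "lam * H \<theta> = lam * g1 \<theta> - lam * g2 \<theta> - (k1 - k2)"
      using \<open>lam \<noteq> 0\<close> by (simp add: H_def field_simps)
    ultimately show ?thesis using k1[OF that] k2[OF that] by linarith
  qed
  have lim: "(H1 \<longlongrightarrow> 0) (at_left (pi / 2))" "(H1 \<longlongrightarrow> 0) (at_right (- pi / 2))"
    using tendsto_diff[OF g_lim(1,3)] tendsto_diff[OF g_lim(2,4)] by (simp_all add: H1_def)
  obtain G where G: "(\<lambda>p. G (snd p)) \<in> eigenspace_LB b lam" "\<And>\<theta>. \<theta> \<in> latitudes \<Longrightarrow> G \<theta> = complex_of_real (H \<theta>)"
    using zonal_solution_in_eigenspace[OF b H Heq lim] by blast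
  have H0: "H \<theta> = 0" if "\<theta> \<in> latitudes" for \<theta>
    using G(2)[OF that] zonal_zero[OF G(1), of \<theta>] by simp
  have d0: "deriv g1 \<theta> = deriv g2 \<theta>" if \<theta>: "\<theta> \<in> latitudes" for \<theta>
  proof -
    have dH: "(H has_vector_derivative H1 \<theta>) (at \<theta>)" using H \<theta> by (simp add: C2_data_def)
    have "((\<lambda>_. 0) has_vector_derivative H1 \<theta>) (at \<theta>)"
      by (rule has_vector_derivative_transform_within_open[OF dH _ \<theta>]) (simp_all add: H0)
    then have "H1 \<theta> = 0" using vector_derivative_unique_at[OF _ has_vector_derivative_const] by blast
    then show ?thesis by (simp add: H1_def)
  qed
  \<comment> \<open>The formula depends on \<open>g\<close> only through \<open>deriv g\<close>, so
    a constant difference drops out.\<close>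
  have vel: "velocity b (\<lambda>q. of_real (g (snd q)) + Y q) p =
      (- (1 / rho b (snd p)) *\<^sub>R modes \<kappa> (\<lambda>x. of_real (deriv g x)) (\<lambda>\<theta>. c1 * y1' \<theta>) (\<lambda>\<theta>. c2 * y2' \<theta>) p,
       (1 / cos (snd p)) *\<^sub>R modes \<kappa> (\<lambda>_. 0) (\<lambda>\<theta>. \<kappa> * (c1 * y1 \<theta>)) (\<lambda>\<theta>. - \<kappa> * (c2 * y2 \<theta>)) p)"
    if g: "C2_data g (deriv g) (deriv (deriv g))" and p: "snd p \<in> latitudes" for g p
  proof -
    have "(\<lambda>q. of_real (g (snd q)) + Y q) = modes \<kappa> (\<lambda>x. of_real (g x)) (\<lambda>\<theta>. c1 * y1 \<theta>) (\<lambda>\<theta>. c2 * y2 \<theta>)"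
      by (simp add: Y modes_def fun_eq_iff)
    moreover have "C2_data (\<lambda>x. complex_of_real (g x)) (\<lambda>x. of_real (deriv g x)) (\<lambda>x. of_real (deriv (deriv g) x))"
      using g by (auto simp: C2_data_def has_real_derivative_iff_has_vector_derivative[symmetric] intro!: has_vector_derivative_of_real)
    ultimately show ?thesis
      by (simp only: velocity_def dphi_modes dtheta_modes[OF _ A B p])
  qed
  show ?thesis
  proof (intro conjI allI impI)
    show "\<exists>c. \<forall>\<theta>\<in>latitudes. g1 \<theta> - g2 \<theta> = c"
      using H0 by (intro exI[of _ "(k1 - k2) / lam"]) (simp add: H_def)
    fix p :: "real \<times> real" assume p: "snd p \<in> latitudes"
    show "velocity b (\<lambda>q. of_real (g1 (snd q)) + Y q) p = velocity b (\<lambda>q. of_real (g2 (snd q)) + Y q) p"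
      unfolding vel[OF C1 p] vel[OF C2 p] by (simp add: modes_def d0[OF p])
  qed
qed

end
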